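(* Consider instances $(G,\Gamma)$ of the general model (GM) with $u\equiv 1$, i.e. $u_a=1$ for all $a\in A$. Then, for arbitrary $\Gamma\ge 1$, an optimal solution to (GM) can be determined in polynomial time.
   Context: $\mathbb{N}=\{1,2,\dots\}$. $G=(V,A,s,t,u)$ is a finite directed graph (parallel arcs allowed) with two distinct nodes, source $s$ and sink $t$, and capacities $u_a\in\mathbb{N}$ for $a\in A$. The source $s$ has no incoming arcs, $t$ has no outgoing arcs, and for every $v\in V\setminus\{s,t\}$ there is a directed $s$-$v$-$t$-path. For $\Gamma\in\mathbb{N}$ let $\mathcal{S}=\{S\subseteq A: |S|\le\Gamma\}$. $\mathcal{P}$ is the set of all simple $s$-$t$-paths, and $\bar{\mathcal{P}}$ is the set of all directed $v$-$w$-paths $P$ ($v,w\in V$, at least one arc) that are subpaths of some path in $\mathcal{P}$; paths are identified with their arc sets. $\delta_{\bar{\mathcal{P}}}^-(v)$ and $\delta_{\bar{\mathcal{P}}}^+(v)$ are the sets of paths in $\bar{\mathcal{P}}$ ending at $v$ and starting at $v$. The general model (GM) is $$f^*_{gm}=\max_{x\in\mathbb{R}^{|\bar{\mathcal{P}}|}_{\ge0}}\ \sum_{P\in\delta_{\bar{\mathcal{P}}}^-(t)}x(P)-\max_{S\in\mathcal{S}}\sum_{P\in\delta_{\bar{\mathcal{P}}}^-(t):P\cap S\ne\emptyset}x(P)$$ subject to $\sum_{P\in\delta_{\bar{\mathcal{P}}}^-(v)}x(P)-\sum_{P\in\delta_{\bar{\mathcal{P}}}^-(v):P\cap S\neq\emptyset}x(P)\ge\sum_{P\in\delta_{\bar{\mathcal{P}}}^+(v)}x(P)$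 for all $v\in V\setminus\{s,t\}$, $S\in\mathcal{S}$, and $\sum_{P\in\bar{\mathcal{P}}:a\in P}x(P)\le u_a$ for all $a\in A$. A solution is output by listing the paths with nonzero flow together with their values. *)

theory Defs
  imports
    "Graph_Theory.Digraph"
    "Graph_Theory.Arc_Walk"
    "HOL-Library.Sublist"
    "HOL-Library.Log_Nat"
    "HOL-Computational_Algebra.Polynomial"
begin

section \<open>The general model\<close>

locale gm_instance = fin_digraph G
  for G :: "('a, 'b) pre_digraph" (structure) +
  fixes s t :: 'a and u :: "'b \<Rightarrow> nat" and \<Gamma> :: nat
  assumes source_in_verts: "s \<in> verts G"
    and sink_in_verts: "t \<in> verts G"
    and source_neq_sink: "s \<noteq> t"
    and no_arc_into_source: "in_arcs G s = {}"
    and no_arc_out_of_sink: "out_arcs G t = {}"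
    and on_s_t_walk:
      "\<And>v. v \<in> verts G - {s, t} \<Longrightarrow> \<exists>p. awalk s p t \<and> v \<in> set (awalk_verts s p)"
    and cap_pos: "\<And>a. a \<in> arcs G \<Longrightarrow> 1 \<le> u a"
    and budget_pos: "1 \<le> \<Gamma>"
begin

definition scenarios :: "'b set set" where
  "scenarios = {S. S \<subseteq> arcs G \<and> card S \<le> \<Gamma>}"

definition subpath :: "'a \<Rightarrow> 'b list \<Rightarrow> 'a \<Rightarrow> bool" where
  "subpath v p w \<longleftrightarrow> p \<noteq> [] \<and> awalk v p w \<and> (\<exists>q. apath s q t \<and> sublist p q)"

text \<open>As index objects of a flow, paths are identified with their arc sets.\<close>

definition Pbar :: "'b set set" where
  "Pbar = {set p | p. \<exists>v w. subpath v p w}"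

definition Pbar_in :: "'a \<Rightarrow> 'b set set" where
  "Pbar_in v = {set p | p. \<exists>w. subpath w p v}"

definition Pbar_out :: "'a \<Rightarrow> 'b set set" where
  "Pbar_out v = {set p | p. \<exists>w. subpath v p w}"

text \<open>
  A vector indexed by \<^term>\<open>Pbar\<close> is a total function of which only the
  values on \<^term>\<open>Pbar\<close> matter.
\<close>

definition feasible :: "('b set \<Rightarrow> real) \<Rightarrow> bool" where
  "feasible x \<longleftrightarrow>
     (\<forall>P \<in> Pbar. 0 \<le> x P) \<and>
     (\<forall>v \<in> verts G - {s, t}. \<forall>S \<in> scenarios.
        (\<Sum>P \<in> Pbar_in v. x P) - (\<Sum>P \<in> {P \<in> Pbar_in v. P \<inter> S \<noteq> {}}. x P)
          \<ge> (\<Sum>P \<in> Pbar_out v. x P)) \<and>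
     (\<forall>a \<in> arcs G. (\<Sum>P \<in> {P \<in> Pbar. a \<in> P}. x P) \<le> real (u a))"

definition objective :: "('b set \<Rightarrow> real) \<Rightarrow> real" where
  "objective x =
     (\<Sum>P \<in> Pbar_in t. x P)
       - Max ((\<lambda>S. \<Sum>P \<in> {P \<in> Pbar_in t. P \<inter> S \<noteq> {}}. x P) ` scenarios)"

definition optimal :: "('b set \<Rightarrow> real) \<Rightarrow> bool" where
  "optimal x \<longleftrightarrow> feasible x \<and> (\<forall>y. feasible y \<longrightarrow> objective y \<le> objective x)"

text \<open>
  \<open>lists_flow L x\<close>: the list \<open>L\<close> enumerates, without repetition, the paths with
  nonzero flow under \<open>x\<close>. An entry \<open>(p, n, d)\<close> gives the arc sequence \<open>p\<close> of such
  a path and its value as the fraction \<open>n / d\<close>.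
\<close>

definition lists_flow :: "('b list \<times> nat \<times> nat) list \<Rightarrow> ('b set \<Rightarrow> real) \<Rightarrow> bool" where
  "lists_flow L x \<longleftrightarrow>
     distinct (map (\<lambda>(p, n, d). set p) L) \<and>
     (\<lambda>(p, n, d). set p) ` set L = {P \<in> Pbar. x P \<noteq> 0} \<and>
     (\<forall>(p, n, d) \<in> set L.
        (\<exists>v w. subpath v p w) \<and> d \<noteq> 0 \<and> x (set p) = real n / real d)"

end


section \<open>Polynomial time\<close>

text \<open>
  Computation model: while programs over a random access memory, whose cells hold
  natural numbers. The memory consists of arrays named by strings, of which a
  program mentions only finitely many; arrays are unbounded and a scalar variable
  is cell 0 of its array.

  Time is uniform cost: one unit per executed assignment or evaluated test. The
  expressions of a fixed program have bounded size, so counting their operators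
  would change the running time by a constant factor only. As the only arithmetic
  operations are addition and truncated subtraction (no multiplication or shifts),
  executing a command lengthens the binary representation of the largest stored
  number by at most a constant number of bits. Hence polynomial time in this model
  coincides with polynomial time under logarithmic cost and on Turing machines.
\<close>

type_synonym mem = "string \<Rightarrow> nat \<Rightarrow> nat"

datatype aexp = N nat | Cell string aexp | Plus aexp aexp | Minus aexp aexp

datatype bexp = Less aexp aexp | Not bexp | And bexp bexp

datatype com =
    Skip
  | Assign string aexp aexp
  | Seq com com
  | If bexp com com
  | While bexp com

fun aval :: "aexp \<Rightarrow> mem \<Rightarrow> nat" where
  "aval (N n) m = n"
| "aval (Cell x e) m = m x (aval e m)"
| "aval (Plus e1 e2) m = aval e1 m + aval e2 m"
| "aval (Minus e1 e2) m = aval e1 m - aval e2 m"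

fun bval :: "bexp \<Rightarrow> mem \<Rightarrow> bool" where
  "bval (Less e1 e2) m \<longleftrightarrow> aval e1 m < aval e2 m"
| "bval (Not b) m \<longleftrightarrow> \<not> bval b m"
| "bval (And b1 b2) m \<longleftrightarrow> bval b1 m \<and> bval b2 m"

text \<open>
  \<open>exec c m k m'\<close>: started in memory \<open>m\<close>, program \<open>c\<close> halts after exactly \<open>k\<close> steps
  in memory \<open>m'\<close>. The command \<open>Assign x i e\<close> stores the value of \<open>e\<close> in cell number \<open>i\<close> of
  array \<open>x\<close>.
\<close>

inductive exec :: "com \<Rightarrow> mem \<Rightarrow> nat \<Rightarrow> mem \<Rightarrow> bool" where
  Skip: "exec Skip m 1 m"
| Assign: "exec (Assign x i e) m 1 (m(x := (m x)(aval i m := aval e m)))"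
| Seq: "exec c1 m1 k1 m2 \<Longrightarrow> exec c2 m2 k2 m3 \<Longrightarrow> exec (Seq c1 c2) m1 (k1 + k2) m3"
| IfTrue: "bval b m \<Longrightarrow> exec c1 m k m' \<Longrightarrow> exec (If b c1 c2) m (1 + k) m'"
| IfFalse: "\<not> bval b m \<Longrightarrow> exec c2 m k m' \<Longrightarrow> exec (If b c1 c2) m (1 + k) m'"
| WhileFalse: "\<not> bval b m \<Longrightarrow> exec (While b c) m 1 m"
| WhileTrue: "bval b m1 \<Longrightarrow> exec c m1 k1 m2 \<Longrightarrow> exec (While b c) m2 k2 m3 \<Longrightarrow>
    exec (While b c) m1 (1 + k1 + k2) m3"

lemma exec_deterministic:
  "exec c m k m' \<Longrightarrow> exec c m l m'' \<Longrightarrow> l = k \<and> m'' = m'"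
proof (induction arbitrary: l m'' rule: exec.induct)
  case (Skip m)
  then show ?case by (simp add: exec.simps[of Skip])
next
  case (Assign x i e m)
  then show ?case by (simp add: exec.simps[of "Assign _ _ _"])
next
  case (Seq c1 m1 k1 m2 c2 k2 m3)
  from Seq.prems obtain l1 l2 m where
    "exec c1 m1 l1 m" "exec c2 m l2 m''" "l = l1 + l2"
    by cases
  with Seq.IH show ?case by metis
next
  case (IfTrue b m c1 k m' c2)
  from IfTrue.prems IfTrue.hyps obtain l1 where "exec c1 m l1 m''" "l = 1 + l1"
    by cases simp_all
  with IfTrue.IH show ?case by metis
next
  case (IfFalse b m c2 k m' c1)
  from IfFalse.prems IfFalse.hyps obtain l1 where "exec c2 m l1 m''" "l = 1 + l1"
    by cases simp_all
  with IfFalse.IH show ?case by metis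
next
  case (WhileFalse b m c)
  from WhileFalse.prems WhileFalse.hyps show ?case by cases simp_all
next
  case (WhileTrue b m1 c k1 m2 k2 m3)
  from WhileTrue.prems WhileTrue.hyps obtain l1 l2 m where
    "exec c m1 l1 m" "exec (While b c) m l2 m''" "l = 1 + l1 + l2"
    by cases simp_all
  with WhileTrue.IH show ?case by metis
qed

text \<open>
  Input and output are lists of natural numbers, held in an array whose cell 0
  contains the length of the list. All other cells are initially 0.
\<close>

definition initial :: "nat list \<Rightarrow> mem" where
  "initial xs = (\<lambda>x i. if x = ''input'' \<and> i \<le> length xs then (length xs # xs) ! i else 0)"

definition result :: "mem \<Rightarrow> nat list" where
  "result m = map (\<lambda>i. m ''output'' (Suc i)) [0..<m ''output'' 0]"

text \<open>The number of bits of the list, with one separator per entry.\<close>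

definition input_size :: "nat list \<Rightarrow> nat" where
  "input_size xs = (\<Sum>n\<leftarrow>xs. floorlog 2 n + 1)"

text \<open>
  Search problem with instances \<open>I\<close>, encoded by \<open>enc\<close>, where \<open>sol i ys\<close> says that
  \<open>ys\<close> encodes a solution of \<open>i\<close>. The length of the output is charged in addition
  to the running time, since the length in cell 0 could otherwise claim exponentially
  many cells that were never written.
\<close>

definition poly_time_solvable ::
  "'i set \<Rightarrow> ('i \<Rightarrow> nat list) \<Rightarrow> ('i \<Rightarrow> nat list \<Rightarrow> bool) \<Rightarrow> bool" where
  "poly_time_solvable I enc sol \<longleftrightarrow>
     (\<exists>(c :: com) (p :: nat poly). \<forall>i \<in> I. \<exists>k m.
        exec c (initial (enc i)) k m \<and>
        k + length (result m) \<le> poly p (input_size (enc i)) \<and>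
        sol i (result m))"


section \<open>Encoding of instances and solutions\<close>

text \<open>
  Nodes and arcs of the instances handed to a program are named by arbitrary natural
  numbers.
\<close>

type_synonym gm_data =
  "(nat, nat) pre_digraph \<times> nat \<times> nat \<times> (nat \<Rightarrow> nat) \<times> nat"

fun encode_instance :: "gm_data \<Rightarrow> nat list" where
  "encode_instance (G, s, t, u, \<Gamma>) =
     [card (verts G), card (arcs G), s, t, \<Gamma>] @
     sorted_list_of_set (verts G) @
     concat (map (\<lambda>a. [a, tail G a, head G a, u a]) (sorted_list_of_set (arcs G)))"

definition encode_solution :: "(nat list \<times> nat \<times> nat) list \<Rightarrow> nat list" where
  "encode_solution L = length L # concat (map (\<lambda>(p, n, d). length p # p @ [n, d]) L)"

fun encodes_optimal_solution :: "gm_data \<Rightarrow> nat list \<Rightarrow> bool" where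
  "encodes_optimal_solution (G, s, t, u, \<Gamma>) ys \<longleftrightarrow>
     (\<exists>L x. ys = encode_solution L \<and> gm_instance.lists_flow G s t L x \<and>
       gm_instance.optimal G s t u \<Gamma> x)"

end

theory Submission
  imports Defs
begin

text \<open>
  For unit capacities the optimum is \<open>k - min \<Gamma> k\<close>, where \<open>k\<close> is the minimum number of arcs in
  an \<open>s\<close>-\<open>t\<close>-cut. If the adversary deletes \<open>min \<Gamma> k\<close> arcs of a minimum cut, then by conservation
  in this scenario all flow that still reaches \<open>t\<close> crosses the cut on the remaining arcs. Conversely,
  \<open>k\<close> arc-disjoint \<open>s\<close>-\<open>t\<close>-paths with flow 1 each are feasible and lose at most one path per deleted
  arc. Such paths are found by augmenting a 0/1 flow along paths of the residual graph and decomposing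
  the maximum flow; both are instances of one loop that searches backwards from \<open>t\<close> and flips the flow
  along the path found.
\<close>

section \<open>Optimality of arc-disjoint paths along a cut\<close>

text \<open>The program never touches the possibly exponentially many variables of the model,
  because optimality has a short certificate. Every node set \<open>L\<close> that contains
  \<open>t\<close> but not \<open>s\<close> bounds all feasible objectives, and the search that
  fails at the end of the first phase labels such an \<open>L\<close>, with as many entering arcs as
  there are paths. The paths and this \<open>L\<close> are the same for every
  \<open>\<Gamma>\<close>; the budget enters only through the number of cut arcs attacked.

  Flow variables are indexed by arc sets, so the two ends of a path have to be read off from its arc
  set. This makes the families \<open>Pbar_in v\<close> disjoint for different \<open>v\<close>, as
  summing conservation over \<open>L\<close> requires.

  The search runs backwards so that its pointers lead forward from \<open>s\<close>: a path is
  written in output order, preceded by its length, in one pass. Depths that drop along the pointers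
  give termination, distinctness of the arcs and, when only arcs carrying flow are followed, simple
  paths.

  Each round changes the flow value by one, and this value lies between 0 and the number of arcs. A
  search restarts its arc scan after each new label, so the total time is cubic in the input
  length.\<close>

context gm_instance
begin

text \<open>Every inner node of a path is both a tail and a head. Simplicity keeps the start from
  being a head and the end from being a tail, so the arc set alone determines both ends.\<close>

lemma apath_tail_head_diff:
  assumes "apath v p w" "p \<noteq> []"
  shows "tail G ` set p - head G ` set p = {v} \<and> head G ` set p - tail G ` set p = {w}"
  using assms
proof (induction p arbitrary: v)
  case (Cons e es)
  have e: "tail G e = v" "apath (head G e) es w"
    "v \<notin> set (awalk_verts (head G e) es)"
    using Cons.prems by (auto simp: apath_Cons_iff)
  have V: "set (awalk_verts (head G e) es) =
      {head G e} \<union> tail G ` set es \<union> head G ` set es"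
    using e(2) by (auto simp: apath_def set_awalk_verts)
  show ?case
  proof (cases "es = []")
    case True
    with e V show ?thesis by (auto simp: apath_Nil_iff)
  next
    case False
    have "head G e \<in> tail G ` set es"
      using False e(2) by (cases es) (auto simp: apath_Cons_iff)
    moreover have "tail G ` set es - head G ` set es = {head G e}"
      "head G ` set es - tail G ` set es = {w}"
      using Cons.IH False e(2) by simp_all
    ultimately show ?thesis
      using e V by auto
  qed
qed simp

lemma subpath_apath: "subpath v p w \<Longrightarrow> apath v p w"
proof -
  assume "subpath v p w"
  then obtain q where p: "p \<noteq> []" "awalk v p w" and q: "apath s q t" "sublist p q"
    by (auto simp: subpath_def)
  then obtain q1 q2 where "apath s (q1 @ p @ q2) t"
    by (auto simp: sublist_def)
  then have "apath (awlast s q1) p (awlast (awlast s q1) p)"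
    by (auto simp: apath_append_iff)
  \<comment> \<open>A nonempty walk determines its ends, so those of \<open>p\<close> inside the
    simple path are \<open>v\<close> and \<open>w\<close>.\<close>
  with p show "apath v p w"
    by (metis apath_def awalk_ends)
qed

lemma apath_subpath: "apath s p t \<Longrightarrow> subpath s p t"
  using source_neq_sink by (auto simp: subpath_def apath_def awalk_Nil_iff)

lemma subpath_ends:
  assumes "subpath v p w"
  shows "tail G ` set p - head G ` set p = {v}" "head G ` set p - tail G ` set p = {w}"
  using apath_tail_head_diff[OF subpath_apath[OF assms]] assms by (simp_all add: subpath_def)

lemma Pbar_subset: "P \<in> Pbar \<Longrightarrow> P \<subseteq> arcs G"
  by (auto simp: Pbar_def subpath_def)

lemma finite_Pbar: "finite Pbar"
  by (rule finite_subset[of _ "Pow (arcs G)"]) (auto dest: Pbar_subset)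

text \<open>Replaces the hidden walk by a condition on the arc set, from which disjointness for
  different \<open>v\<close> is immediate.\<close>

lemma Pbar_in_conv: "Pbar_in v = {P \<in> Pbar. head G ` P - tail G ` P = {v}}"
proof -
  have "set p \<in> Pbar_in v" if "subpath u p w" "head G ` set p - tail G ` set p = {v}" for u p w
  proof -
    have "w = v" using subpath_ends(2)[OF that(1)] that(2) by simp
    with that show ?thesis by (auto simp: Pbar_in_def)
  qed
  moreover have "Pbar_in v \<subseteq> {P \<in> Pbar. head G ` P - tail G ` P = {v}}"
    using subpath_ends(2) unfolding Pbar_in_def Pbar_def by blast
  ultimately show ?thesis
    unfolding Pbar_def by blast
qed

lemma Pbar_out_conv: "Pbar_out v = {P \<in> Pbar. tail G ` P - head G ` P = {v}}"
proof -
  have "set p \<in> Pbar_out v" if "subpath u p w" "tail G ` set p - head G ` set p = {v}" for u p w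
  proof -
    have "u = v" using subpath_ends(1)[OF that(1)] that(2) by simp
    with that show ?thesis by (auto simp: Pbar_out_def)
  qed
  moreover have "Pbar_out v \<subseteq> {P \<in> Pbar. tail G ` P - head G ` P = {v}}"
    using subpath_ends(1) unfolding Pbar_out_def Pbar_def by blast
  ultimately show ?thesis
    unfolding Pbar_def by blast
qed

lemma Pbar_out_sink: "Pbar_out t = {}"
proof -
  have False if "subpath t p w" for p w
    using that no_arc_out_of_sink by (cases p) (auto simp: subpath_def awalk_Cons_iff)
  then show ?thesis by (auto simp: Pbar_out_def)
qed

lemma finite_scenarios: "finite scenarios"
  by (rule finite_subset[of _ "Pow (arcs G)"]) (auto simp: scenarios_def)

text \<open>A union bound: a path that meets \<open>B\<close> is counted at least once when the
  capacity constraints of all arcs in \<open>B\<close> are added up.\<close>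

lemma sum_hit_le:
  assumes y: "feasible y" and B: "B \<subseteq> arcs G"
  shows "(\<Sum>P \<in> {P \<in> Pbar. P \<inter> B \<noteq> {}}. y P) \<le> (\<Sum>a \<in> B. real (u a))"
proof -
  have fB: "finite B" using B finite_arcs by (rule finite_subset)
  have nn: "0 \<le> y P" if "P \<in> Pbar" for P
    using y that by (auto simp: feasible_def)
  have "(\<Sum>P \<in> {P \<in> Pbar. P \<inter> B \<noteq> {}}. y P) \<le> (\<Sum>P\<in>Pbar. real (card {a \<in> B. a \<in> P}) * y P)"
  proof (rule sum_le_included[where i = id])
    have "y P \<le> real (card {a \<in> B. a \<in> P}) * y P" if "P \<in> Pbar" "P \<inter> B \<noteq> {}" for P
    proof -
      have "0 < card {a \<in> B. a \<in> P}" using that fB by (auto simp: card_gt_0_iff)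
      then have "1 * y P \<le> real (card {a \<in> B. a \<in> P}) * y P"
        using nn[OF that(1)] by (intro mult_right_mono) auto
      then show ?thesis by simp
    qed
    then show "\<forall>P\<in>{P \<in> Pbar. P \<inter> B \<noteq> {}}. \<exists>Q\<in>Pbar. id Q = P \<and>
        y P \<le> real (card {a \<in> B. a \<in> Q}) * y Q" by auto
  qed (use nn finite_Pbar in auto)
  also have "\<dots> = (\<Sum>a\<in>B. \<Sum>P \<in> {P \<in> Pbar. a \<in> P}. y P)"
    using sum.swap_restrict[OF finite_Pbar fB, of "\<lambda>P a. y P" "\<lambda>P a. a \<in> P"] by simp
  also have "\<dots> \<le> (\<Sum>a\<in>B. real (u a))"
    using y B by (intro sum_mono) (auto simp: feasible_def)
  finally show ?thesis .
qed

text \<open>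
  The adversary attacks arcs of a cut. Conservation in this scenario, summed over the sink side,
  shows that all flow reaching the sink has to cross the cut on the remaining arcs.
\<close>

lemma objective_le_cut:
  assumes y: "feasible y" and L: "L \<subseteq> verts G" "t \<in> L" "s \<notin> L"
    and S: "S \<subseteq> {a \<in> arcs G. tail G a \<notin> L \<and> head G a \<in> L}" "S \<in> scenarios"
  shows "objective y \<le> (\<Sum>a \<in> {a \<in> arcs G. tail G a \<notin> L \<and> head G a \<in> L} - S. real (u a))"
proof -
  define C where "C = {a \<in> arcs G. tail G a \<notin> L \<and> head G a \<in> L}"
  define surv where "surv v = (\<Sum>P \<in> {P \<in> Pbar_in v. P \<inter> S = {}}. y P)" for v
  have fL: "finite L" using L(1) finite_verts by (rule finite_subset)
  have fin: "finite (Pbar_in v)" "finite (Pbar_out v)" for v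
    by (simp_all add: Pbar_in_conv Pbar_out_conv finite_Pbar)
  have nn: "0 \<le> y P" if "P \<in> Pbar" for P
    using y that by (auto simp: feasible_def)
  have surv: "surv v = (\<Sum>P \<in> Pbar_in v. y P) - (\<Sum>P \<in> {P \<in> Pbar_in v. P \<inter> S \<noteq> {}}. y P)" for v
  proof -
    have "(\<Sum>P \<in> Pbar_in v. y P) = (\<Sum>P \<in> Pbar_in v - {P \<in> Pbar_in v. P \<inter> S \<noteq> {}}. y P)
        + (\<Sum>P \<in> {P \<in> Pbar_in v. P \<inter> S \<noteq> {}}. y P)"
      using fin by (intro sum.subset_diff) auto
    also have "Pbar_in v - {P \<in> Pbar_in v. P \<inter> S \<noteq> {}} = {P \<in> Pbar_in v. P \<inter> S = {}}" by auto
    finally show ?thesis by (simp add: surv_def)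
  qed
  have cons: "(\<Sum>P \<in> Pbar_out v. y P) \<le> surv v" if "v \<in> L - {t}" for v
    using y S(2) that L unfolding surv feasible_def by blast
  define I where "I = {P \<in> Pbar. P \<inter> S = {} \<and> (\<exists>v\<in>L. head G ` P - tail G ` P = {v})}"
  define Out where "Out = {P \<in> Pbar. \<exists>v\<in>L. tail G ` P - head G ` P = {v}}"
  have fin2: "finite I" "finite Out" by (simp_all add: I_def Out_def finite_Pbar)
  have "(\<Sum>v\<in>L. surv v) = (\<Sum>P\<in>(\<Union>v\<in>L. {P \<in> Pbar_in v. P \<inter> S = {}}). y P)"
    unfolding surv_def using fL
    by (intro sum.UNION_disjoint[symmetric]) (auto simp: Pbar_in_conv finite_Pbar)
  also have "(\<Union>v\<in>L. {P \<in> Pbar_in v. P \<inter> S = {}}) = I"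
    by (auto simp: I_def Pbar_in_conv)
  finally have sI: "(\<Sum>v\<in>L. surv v) = (\<Sum>P\<in>I. y P)" .
  have "(\<Sum>v\<in>L. \<Sum>P \<in> Pbar_out v. y P) = (\<Sum>P\<in>(\<Union>v\<in>L. Pbar_out v). y P)"
    using fL fin by (intro sum.UNION_disjoint[symmetric]) (auto simp: Pbar_out_conv)
  also have "(\<Union>v\<in>L. Pbar_out v) = Out"
    by (auto simp: Out_def Pbar_out_conv)
  finally have sOut: "(\<Sum>v\<in>L - {t}. \<Sum>P \<in> Pbar_out v. y P) = (\<Sum>P\<in>Out. y P)"
    using fL L(2) by (simp add: sum.remove Pbar_out_sink)
  \<comment> \<open>A surviving path that ends in \<open>L\<close> but starts outside has to enter
    \<open>L\<close>, and the entering arc is not attacked.\<close>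
  have cross: "P \<inter> (C - S) \<noteq> {}" if P: "P \<in> I - Out" for P
  proof -
    obtain p v w where p: "P = set p" "subpath v p w" using P by (auto simp: I_def Pbar_def)
    have "v \<notin> L" "w \<in> L" "set p \<inter> S = {}"
      using P p subpath_ends[OF p(2)] by (auto simp: I_def Out_def)
    moreover have "set p \<inter> C \<noteq> {}" if "awalk v p w" "v \<notin> L" "w \<in> L" for v p
      using that
    proof (induction p arbitrary: v)
      case (Cons a p)
      then show ?case
        by (cases "head G a \<in> L") (auto simp: awalk_Cons_iff C_def)
    qed (simp add: awalk_Nil_iff)
    ultimately have "set p \<inter> C \<noteq> {}" using p(2) unfolding subpath_def by blast
    with \<open>set p \<inter> S = {}\<close> show ?thesis unfolding p(1) by blast
  qed
  have "objective y \<le> surv t"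
    unfolding surv objective_def using finite_scenarios S(2)
    by (intro diff_left_mono Max_ge) auto
  also have "\<dots> = (\<Sum>P\<in>I. y P) - (\<Sum>v\<in>L - {t}. surv v)"
    using fL L(2) sI by (simp add: sum.remove)
  also have "\<dots> \<le> (\<Sum>P\<in>I. y P) - (\<Sum>P\<in>Out. y P)"
    unfolding sOut[symmetric] by (intro diff_left_mono sum_mono cons)
  \<comment> \<open>Paths in both families cancel; those only in \<open>Out\<close> are discarded by
    nonnegativity.\<close>
  also have "\<dots> \<le> (\<Sum>P\<in>I - Out. y P)"
  proof -
    have "(\<Sum>P\<in>I. y P) = (\<Sum>P\<in>I - Out. y P) + (\<Sum>P\<in>I \<inter> Out. y P)"
      using sum.Int_Diff[OF fin2(1), of y Out] by simp
    moreover have "(\<Sum>P\<in>I \<inter> Out. y P) \<le> (\<Sum>P\<in>Out. y P)"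
      using fin2 nn by (intro sum_mono2) (auto simp: Out_def)
    ultimately show ?thesis by linarith
  qed
  also have "\<dots> \<le> (\<Sum>P \<in> {P \<in> Pbar. P \<inter> (C - S) \<noteq> {}}. y P)"
    using cross nn by (intro sum_mono2) (auto simp: I_def finite_Pbar)
  also have "\<dots> \<le> (\<Sum>a \<in> C - S. real (u a))"
    using y by (rule sum_hit_le) (auto simp: C_def)
  finally show ?thesis by (simp add: C_def)
qed

section \<open>Guaranteed value of unit flows on disjoint paths\<close>

definition paths_flow :: "'b list list \<Rightarrow> 'b set \<Rightarrow> real" where
  "paths_flow ps P = (if P \<in> set ` set ps then 1 else 0)"

lemma sum_paths_flow:
  assumes "finite A"
  shows "(\<Sum>P\<in>A. paths_flow ps P) = real (card (A \<inter> set ` set ps))"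
  using assms by (simp add: paths_flow_def sum.If_cases)

text \<open>Empty lists are excluded because they could repeat without affecting
  \<open>distinct (concat ps)\<close>.\<close>

lemma disjoint_paths:
  assumes "distinct (concat ps)" "[] \<notin> set ps"
  shows "distinct (map set ps)"
    and "P \<in> set ` set ps \<Longrightarrow> Q \<in> set ` set ps \<Longrightarrow> P \<inter> Q \<noteq> {} \<Longrightarrow> P = Q"
proof -
  have "set p \<inter> set (concat ps) \<noteq> {}" if "set p \<in> set ` set ps" "p \<noteq> []" for p ps
    using that by (cases p) auto
  with assms(1,2) show "distinct (map set ps)"
    by (induction ps) fastforce+
  show "P = Q" if "P \<in> set ` set ps" "Q \<in> set ` set ps" "P \<inter> Q \<noteq> {}"
    using that assms(1) by (auto simp: distinct_concat_iff)
qed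

text \<open>Conservation holds as 0 against 0 in every scenario: no path carrying flow starts or
  ends at an inner node.\<close>

lemma disjoint_paths_feasible:
  assumes ps: "\<And>p. p \<in> set ps \<Longrightarrow> apath s p t" and dist: "distinct (concat ps)"
  shows "feasible (paths_flow ps)"
    and "objective (paths_flow ps) \<ge> real (length ps) - real (min \<Gamma> (length ps))"
    and "set ` set ps \<subseteq> Pbar"
proof -
  have ne: "[] \<notin> set ps"
    using ps[of "[]"] source_neq_sink unfolding apath_Nil_iff by blast
  note disj = disjoint_paths[OF dist ne]
  show sub: "set ` set ps \<subseteq> Pbar"
    using apath_subpath[OF ps] unfolding Pbar_def by blast
  have ends: "tail G ` P - head G ` P = {s}" "head G ` P - tail G ` P = {t}"
    if "P \<in> set ` set ps" for P
    using that ps subpath_ends apath_subpath by blast+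
  have fin: "finite (Pbar_in v)" "finite (Pbar_out v)" for v
    by (simp_all add: Pbar_in_conv Pbar_out_conv finite_Pbar)
  have out0: "Pbar_out v \<inter> set ` set ps = {}" if "v \<noteq> s" for v
    using ends(1) that by (auto simp: Pbar_out_conv)
  have in0: "Pbar_in v \<inter> set ` set ps = {}" if "v \<noteq> t" for v
    using ends(2) that by (auto simp: Pbar_in_conv)
  have int: "Pbar_in t \<inter> set ` set ps = set ` set ps"
    using ends(2) sub by (auto simp: Pbar_in_conv)
  have card_ps: "card (set ` set ps) = length ps"
    using disj(1) by (metis distinct_card length_map list.set_map)
  show "feasible (paths_flow ps)"
    unfolding feasible_def
  proof (intro conjI ballI)
    fix v S assume v: "v \<in> verts G - {s, t}"
    have "{P \<in> Pbar_in v. P \<inter> S \<noteq> {}} \<inter> set ` set ps = {}"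
      using in0[of v] v by auto
    then show "(\<Sum>P \<in> Pbar_out v. paths_flow ps P) \<le> (\<Sum>P \<in> Pbar_in v. paths_flow ps P)
      - (\<Sum>P \<in> {P \<in> Pbar_in v. P \<inter> S \<noteq> {}}. paths_flow ps P)"
      using v in0[of v] out0[of v] by (simp add: sum_paths_flow fin)
  next
    fix a assume a: "a \<in> arcs G"
    have "card ({P \<in> Pbar. a \<in> P} \<inter> set ` set ps) \<le> 1"
      using disj(2) finite_Pbar
      by (subst card_le_Suc0_iff_eq[unfolded One_nat_def[symmetric]]) blast+
    with cap_pos[OF a] show "(\<Sum>P \<in> {P \<in> Pbar. a \<in> P}. paths_flow ps P) \<le> real (u a)"
      by (simp add: sum_paths_flow finite_Pbar)
  qed (simp add: paths_flow_def)
  have hit: "card ({P \<in> Pbar_in t. P \<inter> S \<noteq> {}} \<inter> set ` set ps) \<le> min \<Gamma> (length ps)"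
    if S: "S \<in> scenarios" for S
  proof -
    let ?H = "{P \<in> Pbar_in t. P \<inter> S \<noteq> {}} \<inter> set ` set ps"
    have fS: "finite S" using S finite_arcs by (auto simp: scenarios_def intro: finite_subset)
    \<comment> \<open>Choosing one attacked arc per hit path is injective by disjointness, so at
      most \<open>card S\<close> paths are hit.\<close>
    define g where "g P = (SOME a. a \<in> P \<inter> S)" for P
    have g: "g P \<in> P \<inter> S" if "P \<in> ?H" for P
      unfolding g_def by (rule someI_ex) (use that in auto)
    have "inj_on g ?H"
    proof (rule inj_onI)
      fix P Q assume "P \<in> ?H" "Q \<in> ?H" "g P = g Q"
      then show "P = Q" using disj(2)[of P Q] g[of P] g[of Q] by auto
    qed
    moreover have "g ` ?H \<subseteq> S" using g by auto
    ultimately have "card ?H \<le> card S" using fS by (rule card_inj_on_le)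
    moreover have "card ?H \<le> card (set ` set ps)" by (intro card_mono) auto
    ultimately show ?thesis using S by (simp add: scenarios_def card_ps)
  qed
  have "scenarios \<noteq> {}" by (auto simp: scenarios_def intro!: exI[of _ "{}"])
  then have "Max ((\<lambda>S. \<Sum>P \<in> {P \<in> Pbar_in t. P \<inter> S \<noteq> {}}. paths_flow ps P) ` scenarios)
      \<le> real (min \<Gamma> (length ps))"
    using hit finite_scenarios by (subst Max_le_iff) (auto simp: sum_paths_flow fin)
  then show "objective (paths_flow ps) \<ge> real (length ps) - real (min \<Gamma> (length ps))"
    by (simp add: objective_def sum_paths_flow fin int card_ps)
qed

text \<open>Attacking the cut caps every feasible objective at exactly the value that the paths
  guarantee, since both are the same expression in \<open>\<Gamma>\<close> and the common number
  \<open>length ps\<close>.\<close>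

lemma cut_many_disjoint_paths_optimal:
  assumes ps: "\<And>p. p \<in> set ps \<Longrightarrow> apath s p t" and dist: "distinct (concat ps)"
    and L: "L \<subseteq> verts G" "t \<in> L" "s \<notin> L"
    and len: "length ps = card {a \<in> arcs G. tail G a \<notin> L \<and> head G a \<in> L}"
    and unit: "\<And>a. a \<in> arcs G \<Longrightarrow> u a = 1"
  shows "optimal (paths_flow ps)"
proof -
  let ?C = "{a \<in> arcs G. tail G a \<notin> L \<and> head G a \<in> L}"
  obtain S where S: "S \<subseteq> ?C" "card S = min \<Gamma> (card ?C)"
    using obtain_subset_with_card_n[of "min \<Gamma> (card ?C)" ?C] by auto
  then have sc: "S \<in> scenarios" by (auto simp: scenarios_def)
  have fS: "finite S" using S(1) by (rule finite_subset) simp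
  have "objective y \<le> objective (paths_flow ps)" if y: "feasible y" for y
  proof -
    have "objective y \<le> (\<Sum>a \<in> ?C - S. real (u a))"
      using y L S(1) sc by (rule objective_le_cut)
    also have "\<dots> = (\<Sum>a \<in> ?C - S. 1)"
      using unit by (intro sum.cong) auto
    also have "\<dots> = real (length ps) - real (min \<Gamma> (length ps))"
      using S len fS by (simp add: card_Diff_subset)
    also have "\<dots> \<le> objective (paths_flow ps)"
      using ps dist by (rule disjoint_paths_feasible)
    finally show ?thesis .
  qed
  then show ?thesis
    using disjoint_paths_feasible(1)[OF ps dist] by (auto simp: optimal_def)
qed

lemma disjoint_paths_lists_flow:
  assumes ps: "\<And>p. p \<in> set ps \<Longrightarrow> apath s p t" and dist: "distinct (concat ps)"
  shows "lists_flow (map (\<lambda>p. (p, 1, 1)) ps) (paths_flow ps)"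
proof -
  have ne: "[] \<notin> set ps"
    using ps[of "[]"] source_neq_sink unfolding apath_Nil_iff by blast
  have image: "(\<lambda>(p, n, d). set p) ` set (map (\<lambda>p. (p, 1::nat, 1::nat)) ps) = set ` set ps"
    by force
  show ?thesis
    unfolding lists_flow_def
  proof (intro conjI ballI)
    show "distinct (map (\<lambda>(p, n, d). set p) (map (\<lambda>p. (p, 1::nat, 1::nat)) ps))"
      using disjoint_paths(1)[OF dist ne] by (simp add: comp_def)
    show "(\<lambda>(p, n, d). set p) ` set (map (\<lambda>p. (p, 1::nat, 1::nat)) ps)
        = {P \<in> Pbar. paths_flow ps P \<noteq> 0}"
      unfolding image using disjoint_paths_feasible(3)[OF ps dist]
      by (auto simp: paths_flow_def)
    show "case z of (p, n, d) \<Rightarrow> (\<exists>v w. subpath v p w) \<and> d \<noteq> 0 \<and>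
        paths_flow ps (set p) = real n / real d"
      if z: "z \<in> set (map (\<lambda>p. (p, 1, 1)) ps)" for z
    proof -
      obtain p where p: "z = (p, 1, 1)" "p \<in> set ps" using z by auto
      have "subpath s p t" using apath_subpath[OF ps[OF p(2)]] .
      then show ?thesis using p by (auto simp: paths_flow_def)
    qed
  qed
qed

end


section \<open>Residual search trees\<close>

context fin_digraph
begin

text \<open>
  For \<open>(fw, bw) = (0, 1)\<close> these are the usual residual arcs of a 0/1 flow. For
  \<open>(fw, bw) = (1, 2)\<close> they are the arcs carrying flow, as no arc has value 2.
\<close>

definition residual :: "nat \<Rightarrow> nat \<Rightarrow> ('b \<Rightarrow> nat) \<Rightarrow> 'b \<Rightarrow> 'a \<Rightarrow> 'a \<Rightarrow> bool" where
  "residual fw bw f a v w \<longleftrightarrow> a \<in> arcs G \<and>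
     (f a = fw \<and> tail G a = v \<and> head G a = w \<or> f a = bw \<and> tail G a = w \<and> head G a = v)"

text \<open>On a 0/1 flow, adding a unit to an empty arc and removing one from a full arc are the
  same operation, so augmentation and decomposition can share it.\<close>

definition flip :: "('b \<Rightarrow> nat) \<Rightarrow> 'b set \<Rightarrow> 'b \<Rightarrow> nat" where
  "flip f A a = (if a \<in> A then 1 - f a else f a)"

definition excess :: "('b \<Rightarrow> nat) \<Rightarrow> 'a \<Rightarrow> int" where
  "excess f v = (\<Sum>a\<in>out_arcs G v. int (f a)) - (\<Sum>a\<in>in_arcs G v. int (f a))"

lemma excess_upd:
  assumes a: "a \<in> arcs G"
  shows "excess (f(a := c)) v = excess f v
    + (int c - int (f a)) * (of_bool (tail G a = v) - of_bool (head G a = v))"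
proof -
  have upd: "(\<Sum>b\<in>A. int ((f(a := c)) b))
      = (\<Sum>b\<in>A. int (f b)) + (int c - int (f a)) * of_bool (a \<in> A)" if "finite A" for A
  proof (cases "a \<in> A")
    case True
    with that show ?thesis by (simp add: sum.remove)
  next
    case False
    with that show ?thesis by (auto intro!: sum.cong)
  qed
  have fin: "finite (out_arcs G v)" "finite (in_arcs G v)"
    by (simp_all add: out_arcs_def in_arcs_def)
  have "a \<in> out_arcs G v \<longleftrightarrow> tail G a = v" "a \<in> in_arcs G v \<longleftrightarrow> head G a = v"
    using a by (auto simp: out_arcs_def in_arcs_def)
  then show ?thesis
    unfolding excess_def upd[OF fin(1)] upd[OF fin(2)]
    by (simp add: algebra_simps)
qed

text \<open>Arcs with both ends in \<open>L\<close> contribute \<open>?B\<close> to the outflow and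
  to the inflow and cancel.\<close>

lemma sum_excess:
  assumes "L \<subseteq> verts G"
  shows "(\<Sum>v\<in>L. excess f v)
    = (\<Sum>a\<in>{a \<in> arcs G. tail G a \<in> L \<and> head G a \<notin> L}. int (f a))
      - (\<Sum>a\<in>{a \<in> arcs G. tail G a \<notin> L \<and> head G a \<in> L}. int (f a))"
proof -
  have fL: "finite L" using assms finite_verts by (rule finite_subset)
  let ?B = "\<Sum>a\<in>{a \<in> arcs G. tail G a \<in> L \<and> head G a \<in> L}. int (f a)"
  have "(\<Sum>v\<in>L. \<Sum>a\<in>out_arcs G v. int (f a)) = (\<Sum>a\<in>{a \<in> arcs G. tail G a \<in> L}. int (f a))"
    using fL by (subst sum.UNION_disjoint[symmetric])
      (auto simp: out_arcs_def intro!: sum.cong)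
  also have "\<dots> = ?B + (\<Sum>a\<in>{a \<in> arcs G. tail G a \<in> L \<and> head G a \<notin> L}. int (f a))"
    by (subst sum.union_disjoint[symmetric]) (auto intro!: sum.cong)
  finally have out: "(\<Sum>v\<in>L. \<Sum>a\<in>out_arcs G v. int (f a)) = \<dots>" .
  have "(\<Sum>v\<in>L. \<Sum>a\<in>in_arcs G v. int (f a)) = (\<Sum>a\<in>{a \<in> arcs G. head G a \<in> L}. int (f a))"
    using fL by (subst sum.UNION_disjoint[symmetric])
      (auto simp: in_arcs_def intro!: sum.cong)
  also have "\<dots> = ?B + (\<Sum>a\<in>{a \<in> arcs G. tail G a \<notin> L \<and> head G a \<in> L}. int (f a))"
    by (subst sum.union_disjoint[symmetric]) (auto intro!: sum.cong)
  finally show ?thesis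
    using out by (simp add: excess_def sum_subtractf)
qed

text \<open>A tree directed towards its root \<open>t\<close>, given by total functions because
  these are memory arrays. The bound on \<open>d\<close> limits the length of a path and thereby the
  time to trace it.\<close>

definition search_tree where
  "search_tree fw bw f t L next_arc next_node d \<longleftrightarrow>
     L \<subseteq> verts G \<and> t \<in> L \<and> d t = (0::nat) \<and> (\<forall>v\<in>L. d v < card L) \<and>
     (\<forall>v\<in>L - {t}. residual fw bw f (next_arc v) v (next_node v) \<and>
        next_node v \<in> L \<and> d v = Suc (d (next_node v)))"

lemma search_tree_next:
  assumes "search_tree fw bw f t L na nv d" "v \<in> L" "v \<noteq> t"
  shows "residual fw bw f (na v) v (nv v)" "nv v \<in> L" "d v = Suc (d (nv v))"
  using assms unfolding search_tree_def by blast+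

lemma search_tree_nodes:
  assumes "search_tree fw bw f t L na nv d"
  shows "L \<subseteq> verts G" "t \<in> L" "d t = 0" "v \<in> L \<Longrightarrow> d v < card L"
  using assms unfolding search_tree_def by blast+

text \<open>The recursion is on a step counter, in use always the depth, since following pointers in
  arbitrary arrays need not end.\<close>

primrec tree_path where
  "tree_path next_arc next_node 0 v = []"
| "tree_path next_arc next_node (Suc k) v =
     next_arc v # tree_path next_arc next_node k (next_node v)"

lemma length_tree_path [simp]: "length (tree_path na nv k v) = k"
  by (induction k arbitrary: v) auto

lemma search_tree_root:
  "t \<in> verts G \<Longrightarrow> d t = 0 \<Longrightarrow> search_tree fw bw f t {t} na nv d"
  by (simp add: search_tree_def)

lemma residual_verts: "residual fw bw f a v w \<Longrightarrow> v \<in> verts G \<and> w \<in> verts G"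
  by (auto simp: residual_def)

text \<open>Pointers of old nodes stay inside \<open>L\<close>, so overwriting the entries of the
  new node \<open>v\<close> disturbs none of them.\<close>

lemma search_tree_insert:
  assumes T: "search_tree fw bw f t L na nv d"
    and r: "residual fw bw f a v w" "w \<in> L" "v \<notin> L"
  shows "search_tree fw bw f t (insert v L) (na(v := a)) (nv(v := w)) (d(v := Suc (d w)))"
proof -
  note nodes = search_tree_nodes[OF T] and nxt = search_tree_next[OF T]
  have fL: "finite L" using nodes(1) finite_verts by (rule finite_subset)
  have vt: "v \<noteq> t" using r(3) nodes(2) by blast
  have vw: "v \<noteq> w" using r(2,3) by blast
  show ?thesis
    unfolding search_tree_def
  proof (intro conjI ballI)
    show "insert v L \<subseteq> verts G" using nodes(1) residual_verts[OF r(1)] by blast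
    show "t \<in> insert v L" using nodes(2) by blast
    show "(d(v := Suc (d w))) t = 0" using nodes(3) vt by simp
    show "(d(v := Suc (d w))) x < card (insert v L)" if "x \<in> insert v L" for x
      using that nodes(4)[of x] nodes(4)[OF r(2)] fL r(3) by (cases "x = v") simp_all
    fix x assume x: "x \<in> insert v L - {t}"
    have "residual fw bw f ((na(v := a)) x) x ((nv(v := w)) x) \<and> (nv(v := w)) x \<in> insert v L \<and>
      (d(v := Suc (d w))) x = Suc ((d(v := Suc (d w))) ((nv(v := w)) x))"
    proof (cases "x = v")
      case True
      with r vw show ?thesis by simp
    next
      case False
      with x have xL: "x \<in> L" "x \<noteq> t" by blast+
      have "nv x \<noteq> v" using nxt(2)[OF xL] r(3) by blast
      with nxt[OF xL] False show ?thesis by simp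
    qed
    then show "residual fw bw f ((na(v := a)) x) x ((nv(v := w)) x)"
      "(nv(v := w)) x \<in> insert v L"
      "(d(v := Suc (d w))) x = Suc ((d(v := Suc (d w))) ((nv(v := w)) x))"
      by blast+
  qed
qed

text \<open>The value of an arc decides whether it is used forwards or backwards, hence where it
  starts.\<close>

lemma residual_tail_unique:
  assumes "residual fw bw f a v w" "residual fw bw f a v' w'" "fw \<noteq> bw"
  shows "v = v'"
  using assms by (auto simp: residual_def)

lemma tree_path_induct [consumes 2, case_names root step]:
  assumes T: "search_tree fw bw f t L na nv d" and "v \<in> L"
    and root: "P t"
    and step: "\<And>v. v \<in> L \<Longrightarrow> v \<noteq> t \<Longrightarrow> nv v \<in> L \<Longrightarrow> d v = Suc (d (nv v)) \<Longrightarrow>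
      residual fw bw f (na v) v (nv v) \<Longrightarrow> P (nv v) \<Longrightarrow> P v"
  shows "P v"
  using \<open>v \<in> L\<close>
proof (induction "d v" arbitrary: v rule: less_induct)
  case less
  show ?case
  proof (cases "v = t")
    case False
    note nxt = search_tree_next[OF T less.prems False]
    have "d (nv v) < d v" using nxt(3) by simp
    then have "P (nv v)" using less.hyps nxt(2) by blast
    with step[OF less.prems False nxt(2,3,1)] show ?thesis .
  qed (simp add: root)
qed

lemma tree_path_arcs:
  assumes T: "search_tree fw bw f t L na nv d" and "v \<in> L"
  shows "set (tree_path na nv (d v) v) \<subseteq> na ` {w \<in> L - {t}. d w \<le> d v}"
  using T \<open>v \<in> L\<close>
proof (induction rule: tree_path_induct)
  case (step v)
  have "na ` {w \<in> L - {t}. d w \<le> d (nv v)} \<subseteq> na ` {w \<in> L - {t}. d w \<le> d v}"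
    using step(4) by (intro image_mono) auto
  moreover have "na v \<in> na ` {w \<in> L - {t}. d w \<le> d v}"
    using step(1,2) by simp
  ultimately show ?case
    using step(6) unfolding step(4) tree_path.simps(2) by auto
qed (simp add: search_tree_nodes[OF T])

text \<open>A repeated arc would be the next arc of a second node of smaller depth, yet an arc
  leaves only one node in the residual graph.\<close>

lemma next_arc_notin_tree_path:
  assumes T: "search_tree fw bw f t L na nv d" and v: "v \<in> L" "v \<noteq> t" and "fw \<noteq> bw"
  shows "na v \<notin> set (tree_path na nv (d (nv v)) (nv v))"
proof
  assume "na v \<in> set (tree_path na nv (d (nv v)) (nv v))"
  moreover have nv: "nv v \<in> L" "d v = Suc (d (nv v))" "residual fw bw f (na v) v (nv v)"
    using search_tree_next[OF T v] by blast+
  ultimately obtain w where w: "w \<in> L - {t}" "d w \<le> d (nv v)" "na v = na w"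
    using tree_path_arcs[OF T nv(1)] by auto
  then have "residual fw bw f (na v) w (nv w)"
    using search_tree_next(1)[OF T, of w] by simp
  then have "v = w" using residual_tail_unique nv(3) \<open>fw \<noteq> bw\<close> by blast
  then show False using w nv by simp
qed

lemma distinct_tree_path:
  assumes T: "search_tree fw bw f t L na nv d" and v: "v \<in> L" and "fw \<noteq> bw"
  shows "distinct (tree_path na nv (d v) v)"
  using T v
proof (induction rule: tree_path_induct)
  case (step v)
  then show ?case
    using next_arc_notin_tree_path[OF T step(1,2) \<open>fw \<noteq> bw\<close>] by simp
qed (simp add: search_tree_nodes(3)[OF T])

text \<open>The changes telescope along the path. The factor \<open>1 - 2 * int fw\<close> is 1 when
  a unit is pushed (\<open>fw = 0\<close>) and -1 when one is removed (\<open>fw = 1\<close>); in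
  the latter case \<open>bw = 2\<close> exceeds every value of \<open>f\<close>, so no arc is used
  backwards.\<close>

lemma excess_flip_tree_path:
  assumes T: "search_tree fw bw f t L na nv d" and v: "v \<in> L"
    and fw: "fw \<le> 1" and bw: "bw = Suc fw" and f: "\<And>a. a \<in> arcs G \<Longrightarrow> f a \<le> 1"
  shows "excess (flip f (set (tree_path na nv (d v) v))) x
    = excess f x + (1 - 2 * int fw) * (of_bool (x = v) - of_bool (x = t))"
  using T v
proof (induction rule: tree_path_induct)
  case root
  have "flip f {} = f" by (auto simp: flip_def)
  then show ?case by (simp add: search_tree_nodes(3)[OF T])
next
  case (step v)
  let ?g = "flip f (set (tree_path na nv (d (nv v)) (nv v)))"
  have na: "na v \<in> arcs G" using step by (simp add: residual_def)
  have "na v \<notin> set (tree_path na nv (d (nv v)) (nv v))"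
    using next_arc_notin_tree_path[OF T step(1,2)] bw by simp
  then have g: "?g (na v) = f (na v)"
    and eq: "flip f (set (tree_path na nv (d v) v)) = ?g(na v := 1 - f (na v))"
    using step by (auto simp: flip_def)
  have r: "residual fw bw f (na v) v (nv v)" and ne: "v \<noteq> nv v"
    using step by auto
  show ?case
    unfolding eq excess_upd[OF na] g step.IH
    using r ne f[OF na] fw bw by (auto simp: residual_def)
qed

text \<open>No arc has value 2, so all arcs are followed forwards. The depth bound on the visited
  nodes is carried along to show that the next, deeper node is new.\<close>

lemma tree_path_apath:
  assumes T: "search_tree 1 2 f t L na nv d" and v: "v \<in> L"
    and f: "\<And>a. a \<in> arcs G \<Longrightarrow> f a \<le> 1"
  shows "apath v (tree_path na nv (d v) v) t \<and>
    set (awalk_verts v (tree_path na nv (d v) v)) \<subseteq> {w. d w \<le> d v} \<and>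
    (\<forall>a\<in>set (tree_path na nv (d v) v). f a = 1)"
  using T v
proof (induction rule: tree_path_induct)
  case root
  then show ?case
    using search_tree_nodes(1-3)[OF T] by (auto simp: apath_Nil_iff)
next
  case (step v)
  then have "na v \<in> arcs G" "tail G (na v) = v" "head G (na v) = nv v" "f (na v) = 1"
    using f[of "na v"] by (auto simp: residual_def)
  with step show ?case by (fastforce simp: apath_Cons_iff)
qed

definition residual_closed where
  "residual_closed fw bw f L \<longleftrightarrow> (\<forall>a v w. residual fw bw f a v w \<longrightarrow> w \<in> L \<longrightarrow> v \<in> L)"

lemma residual_closedD:
  "residual_closed fw bw f L \<Longrightarrow> residual fw bw f a v w \<Longrightarrow> w \<in> L \<Longrightarrow> v \<in> L"
  by (auto simp: residual_closed_def)

end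

section \<open>Flow value and cuts\<close>

context gm_instance
begin

definition is_flow :: "('b \<Rightarrow> nat) \<Rightarrow> bool" where
  "is_flow f \<longleftrightarrow> (\<forall>a\<in>arcs G. f a \<le> 1) \<and> (\<forall>v\<in>verts G - {s, t}. excess f v = 0)"

lemma excess_source: "excess f s = (\<Sum>a\<in>out_arcs G s. int (f a))"
  by (simp add: excess_def no_arc_into_source)

text \<open>These bounds turn the flow value into a measure for the rounds of both phases, rising in
  the first and falling in the second.\<close>

lemma excess_source_bounds:
  assumes "is_flow f"
  shows "0 \<le> excess f s" "excess f s \<le> int (card (arcs G))"
proof -
  have fin: "finite (out_arcs G s)" by (simp add: out_arcs_def)
  show "0 \<le> excess f s" by (simp add: excess_source sum_nonneg)
  have "(\<Sum>a\<in>out_arcs G s. int (f a)) \<le> (\<Sum>a\<in>arcs G. 1)"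
    using assms by (intro order.trans[OF sum_mono sum_mono2])
      (auto simp: is_flow_def out_arcs_def)
  then show "excess f s \<le> int (card (arcs G))" by (simp add: excess_source)
qed

lemma excess_sink:
  assumes "is_flow f"
  shows "excess f t = - excess f s"
proof -
  have "(\<Sum>v\<in>verts G. excess f v) = (\<Sum>v\<in>{s, t}. excess f v)"
    using assms source_in_verts sink_in_verts
    by (intro sum.mono_neutral_right) (auto simp: is_flow_def)
  moreover have "(\<Sum>v\<in>verts G. excess f v) = 0"
  proof -
    have none: "{a \<in> arcs G. tail G a \<in> verts G \<and> head G a \<notin> verts G} = {}"
      "{a \<in> arcs G. tail G a \<notin> verts G \<and> head G a \<in> verts G} = {}" by auto
    show ?thesis by (simp only: sum_excess[OF order.refl] none sum.empty diff_self)
  qed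
  ultimately show ?thesis using source_neq_sink by simp
qed

lemma flow_across_cut:
  assumes f: "is_flow f" and L: "L \<subseteq> verts G" "t \<in> L" "s \<notin> L"
  shows "excess f s = (\<Sum>a\<in>{a \<in> arcs G. tail G a \<notin> L \<and> head G a \<in> L}. int (f a))
    - (\<Sum>a\<in>{a \<in> arcs G. tail G a \<in> L \<and> head G a \<notin> L}. int (f a))"
proof -
  have "finite L" using L(1) finite_verts by (rule finite_subset)
  then have "(\<Sum>v\<in>L. excess f v) = (\<Sum>v\<in>{t}. excess f v)"
    using f L by (intro sum.mono_neutral_right) (auto simp: is_flow_def)
  then show ?thesis
    using sum_excess[OF L(1), of f] excess_sink[OF f] by simp
qed

text \<open>The max-flow min-cut argument: an empty arc entering \<open>L\<close> or a full arc
  leaving it would be residual and pull its other end into \<open>L\<close>.\<close>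

lemma max_flow_closed:
  assumes f: "is_flow f" and L: "L \<subseteq> verts G" "t \<in> L" "s \<notin> L"
    and cl: "residual_closed 0 1 f L"
  shows "excess f s = int (card {a \<in> arcs G. tail G a \<notin> L \<and> head G a \<in> L})"
proof -
  have "f a = 1" if "a \<in> arcs G" "tail G a \<notin> L" "head G a \<in> L" for a
  proof -
    have "f a \<noteq> 0" using residual_closedD[OF cl, of a "tail G a" "head G a", unfolded residual_def] that by metis
    moreover have "f a \<le> 1" using f that by (auto simp: is_flow_def)
    ultimately show ?thesis by simp
  qed
  moreover have "f a = 0" if "a \<in> arcs G" "tail G a \<in> L" "head G a \<notin> L" for a
  proof -
    have "f a \<noteq> 1" using residual_closedD[OF cl, of a "head G a" "tail G a", unfolded residual_def] that by metis
    moreover have "f a \<le> 1" using f that by (auto simp: is_flow_def)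
    ultimately show ?thesis by simp
  qed
  ultimately show ?thesis by (simp add: flow_across_cut[OF f L])
qed

text \<open>When no path from \<open>s\<close> to \<open>t\<close> carries flow, every arc entering
  \<open>L\<close> is empty and the value is 0. Cycles may still carry flow; they are never
  written.\<close>

lemma no_flow_closed:
  assumes f: "is_flow f" and L: "L \<subseteq> verts G" "t \<in> L" "s \<notin> L"
    and cl: "residual_closed 1 2 f L"
  shows "excess f s = 0"
proof -
  have "f a = 0" if "a \<in> arcs G" "tail G a \<notin> L" "head G a \<in> L" for a
  proof -
    have "f a \<noteq> 1" using residual_closedD[OF cl, of a "tail G a" "head G a", unfolded residual_def] that by metis
    moreover have "f a \<le> 1" using f that by (auto simp: is_flow_def)
    ultimately show ?thesis by simp
  qed
  then have "excess f s \<le> 0"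
    using flow_across_cut[OF f L] by (simp add: sum_nonneg)
  with excess_source_bounds(1)[OF f] show ?thesis by simp
qed

lemma flip_flow:
  assumes f: "is_flow f" and T: "search_tree fw bw f t L na nv d" and s: "s \<in> L"
    and fw: "fw \<le> 1" and bw: "bw = Suc fw"
  shows "is_flow (flip f (set (tree_path na nv (d s) s)))"
    and "excess (flip f (set (tree_path na nv (d s) s))) s = excess f s + 1 - 2 * int fw"
proof -
  have 1: "f a \<le> 1" if "a \<in> arcs G" for a using f that by (simp add: is_flow_def)
  note e = excess_flip_tree_path[OF T s fw bw 1, simplified]
  show "is_flow (flip f (set (tree_path na nv (d s) s)))"
    using f by (auto simp: is_flow_def e) (auto simp: flip_def)
  show "excess (flip f (set (tree_path na nv (d s) s))) s = excess f s + 1 - 2 * int fw"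
    using source_neq_sink by (simp add: e)
qed

end


section \<open>Timed reasoning about programs\<close>

definition reaches :: "com \<Rightarrow> mem \<Rightarrow> nat \<Rightarrow> (mem \<Rightarrow> bool) \<Rightarrow> bool" where
  "reaches c m T Q \<longleftrightarrow> (\<exists>k m'. exec c m k m' \<and> k \<le> T \<and> Q m')"

lemma reaches_mono:
  "reaches c m T Q \<Longrightarrow> T \<le> T' \<Longrightarrow> (\<And>m'. Q m' \<Longrightarrow> Q' m') \<Longrightarrow> reaches c m T' Q'"
  unfolding reaches_def by (meson order_trans)

lemma reaches_Seq:
  assumes "reaches c1 m T1 R" and "\<And>m'. R m' \<Longrightarrow> reaches c2 m' T2 Q"
  shows "reaches (Seq c1 c2) m (T1 + T2) Q"
  using assms unfolding reaches_def by (meson add_mono exec.Seq)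

text \<open>The strictly decreasing \<open>V\<close> also bounds the number of iterations; each
  costs its test and the body, and one last failing test is added.\<close>

lemma reaches_While:
  fixes V :: "mem \<Rightarrow> nat"
  assumes "I m"
    and step: "\<And>m. I m \<Longrightarrow> bval b m \<Longrightarrow> reaches c m T (\<lambda>m'. I m' \<and> V m' < V m)"
    and exit: "\<And>m. I m \<Longrightarrow> \<not> bval b m \<Longrightarrow> Q m"
  shows "reaches (While b c) m (1 + (1 + T) * V m) Q"
  using \<open>I m\<close>
proof (induction "V m" arbitrary: m rule: less_induct)
  case less
  show ?case
  proof (cases "bval b m")
    case False
    with exit[OF less.prems] show ?thesis
      unfolding reaches_def using exec.WhileFalse by fastforce
  next
    case True
    then obtain k m' where m': "exec c m k m'" "k \<le> T" "I m'" "V m' < V m"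
      using step[OF less.prems] unfolding reaches_def by blast
    then obtain k' m'' where m'': "exec (While b c) m' k' m''" "k' \<le> 1 + (1 + T) * V m'" "Q m''"
      using less.hyps unfolding reaches_def by blast
    have "(1 + T) * Suc (V m') \<le> (1 + T) * V m"
      using m'(4) by (intro mult_le_mono) auto
    then have "1 + k + k' \<le> 1 + (1 + T) * V m"
      using m'(2) m''(2) by simp
    with True m' m'' show ?thesis
      unfolding reaches_def using exec.WhileTrue by blast
  qed
qed

text \<open>
  Meant for loop-free programs only: a loop has the precondition \<open>False\<close>, which makes its
  cost irrelevant.
\<close>

fun wp :: "com \<Rightarrow> (mem \<Rightarrow> bool) \<Rightarrow> mem \<Rightarrow> bool" where
  "wp Skip Q m \<longleftrightarrow> Q m"
| "wp (Assign x i e) Q m \<longleftrightarrow> Q (m(x := (m x)(aval i m := aval e m)))"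
| "wp (Seq c1 c2) Q m \<longleftrightarrow> wp c1 (wp c2 Q) m"
| "wp (If b c1 c2) Q m \<longleftrightarrow> (bval b m \<longrightarrow> wp c1 Q m) \<and> (\<not> bval b m \<longrightarrow> wp c2 Q m)"
| "wp (While b c) Q m \<longleftrightarrow> False"

fun cost :: "com \<Rightarrow> nat" where
  "cost (Seq c1 c2) = cost c1 + cost c2"
| "cost (If b c1 c2) = 1 + max (cost c1) (cost c2)"
| "cost _ = 1"

lemma wp_reaches: "wp c Q m \<Longrightarrow> reaches c m (cost c) Q"
proof (induction c arbitrary: m Q)
  case (Seq c1 c2)
  from Seq.IH(1)[of "wp c2 Q" m] Seq.prems Seq.IH(2) show ?case
    by (auto intro: reaches_Seq)
next
  case (If b c1 c2)
  show ?case
  proof (cases "bval b m")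
    case True
    with If obtain k m' where "exec c1 m k m'" "k \<le> cost c1" "Q m'"
      unfolding reaches_def by fastforce
    with True show ?thesis
      unfolding reaches_def using exec.IfTrue[OF True, of c1 k m' c2]
      by (intro exI[of _ "1 + k"] exI[of _ m']) auto
  next
    case False
    with If obtain k m' where "exec c2 m k m'" "k \<le> cost c2" "Q m'"
      unfolding reaches_def by fastforce
    with False show ?thesis
      unfolding reaches_def using exec.IfFalse[OF False, of c2 k m' c1]
      by (intro exI[of _ "1 + k"] exI[of _ m']) auto
  qed
next
  case Skip
  with exec.Skip[of m] show ?case by (force simp: reaches_def)
next
  case (Assign x i e)
  with exec.Assign[of x i e m] show ?case by (force simp: reaches_def)
qed simp

definition stored :: "(nat \<Rightarrow> nat) \<Rightarrow> nat \<Rightarrow> nat list \<Rightarrow> bool" where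
  "stored out pos xs \<longleftrightarrow> (\<forall>i<length xs. out (pos + i) = xs ! i)"

lemma stored_Cons: "stored out pos (x # xs) \<longleftrightarrow> out pos = x \<and> stored out (Suc pos) xs"
  by (force simp: stored_def nth_Cons less_Suc_eq_0_disj split: nat.split)

lemma stored_append:
  "stored out pos (xs @ ys) \<longleftrightarrow> stored out pos xs \<and> stored out (pos + length xs) ys"
  by (induction xs arbitrary: pos) (auto simp: stored_Cons stored_def[of _ _ "[]"])

lemma stored_Nil: "stored out pos []"
  by (simp add: stored_def)

lemma stored_upd: "pos + length xs \<le> i \<Longrightarrow> stored (out(i := y)) pos xs = stored out pos xs"
  by (auto simp: stored_def)

lemma stored_cong:
  "stored out pos xs \<Longrightarrow> (\<And>i. i < pos + length xs \<Longrightarrow> out' i = out i) \<Longrightarrow> stored out' pos xs"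
  by (auto simp: stored_def)


section \<open>The program\<close>

abbreviation var :: "string \<Rightarrow> aexp" where
  "var x \<equiv> Cell x (N 0)"

definition Eq :: "aexp \<Rightarrow> aexp \<Rightarrow> bexp" where
  "Eq e1 e2 = And (Not (Less e1 e2)) (Not (Less e2 e1))"

lemma bval_Eq [simp]: "bval (Eq e1 e2) m \<longleftrightarrow> aval e1 m = aval e2 m"
  by (auto simp: Eq_def)

text \<open>Entry \<open>i\<close> of the record of arc number \<open>j\<close>: 0 is its name, 1 its tail, 2 its head.\<close>

definition field :: "nat \<Rightarrow> aexp" where
  "field i = Cell ''input'' (Plus (Plus (N (6 + i)) (Cell ''input'' (N 1)))
     (Plus (Plus (var ''j'') (var ''j'')) (Plus (var ''j'') (var ''j''))))"

text \<open>Resetting \<open>j\<close> restarts the scan, as arcs passed earlier may lead to the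
  node labelled now. It comes last because \<open>field\<close> depends on \<open>j\<close>.\<close>

definition visit :: "nat \<Rightarrow> nat \<Rightarrow> com" where
  "visit i k =
     Seq (Assign ''lab'' (field i) (var ''r''))
    (Seq (Assign ''arc'' (field i) (field 0))
    (Seq (Assign ''node'' (field i) (field k))
    (Seq (Assign ''depth'' (field i) (Plus (Cell ''depth'' (field k)) (N 1)))
         (Assign ''j'' (N 0) (N 0)))))"

definition search_step :: "nat \<Rightarrow> nat \<Rightarrow> com" where
  "search_step fw bw =
     If (And (Eq (Cell ''lab'' (field 2)) (var ''r''))
          (And (Not (Eq (Cell ''lab'' (field 1)) (var ''r'')))
            (Eq (Cell ''flow'' (field 0)) (N fw))))
       (visit 1 2)
    (If (And (Eq (Cell ''lab'' (field 1)) (var ''r''))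
          (And (Not (Eq (Cell ''lab'' (field 2)) (var ''r'')))
            (Eq (Cell ''flow'' (field 0)) (N bw))))
       (visit 2 1)
       (Assign ''j'' (N 0) (Plus (var ''j'') (N 1))))"

text \<open>The fresh label \<open>r\<close> of each search spares clearing the labels of earlier ones.\<close>

definition search_init :: com where
  "search_init =
     Seq (Assign ''r'' (N 0) (Plus (var ''r'') (N 1)))
    (Seq (Assign ''lab'' (Cell ''input'' (N 4)) (var ''r''))
    (Seq (Assign ''depth'' (Cell ''input'' (N 4)) (N 0))
         (Assign ''j'' (N 0) (N 0))))"

definition search :: "nat \<Rightarrow> nat \<Rightarrow> com" where
  "search fw bw =
     Seq search_init (While (Less (var ''j'') (Cell ''input'' (N 2))) (search_step fw bw))"

text \<open>The depth of \<open>s\<close> is the length of the path, so the length can be written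
  before the path is traversed.\<close>

definition trace_init :: com where
  "trace_init =
     Seq (Assign ''v'' (N 0) (Cell ''input'' (N 3)))
    (Seq (Assign ''output'' (var ''pos'') (Cell ''depth'' (Cell ''input'' (N 3))))
         (Assign ''pos'' (N 0) (Plus (var ''pos'') (N 1))))"

definition trace_step :: com where
  "trace_step =
     Seq (Assign ''output'' (var ''pos'') (Cell ''arc'' (var ''v'')))
    (Seq (Assign ''pos'' (N 0) (Plus (var ''pos'') (N 1)))
    (Seq (Assign ''flow'' (Cell ''arc'' (var ''v''))
           (Minus (N 1) (Cell ''flow'' (Cell ''arc'' (var ''v'')))))
         (Assign ''v'' (N 0) (Cell ''node'' (var ''v'')))))"

definition trace_end :: com where
  "trace_end =
     Seq (Assign ''output'' (var ''pos'') (N 1))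
    (Seq (Assign ''output'' (Plus (var ''pos'') (N 1)) (N 1))
    (Seq (Assign ''pos'' (N 0) (Plus (var ''pos'') (N 2)))
         (Assign ''cnt'' (N 0) (Plus (var ''cnt'') (N 1)))))"

definition trace :: com where
  "trace =
     Seq trace_init
    (Seq (While (Not (Eq (var ''v'') (Cell ''input'' (N 4)))) trace_step)
         trace_end)"

definition phase :: "nat \<Rightarrow> nat \<Rightarrow> com" where
  "phase fw bw =
     Seq (search fw bw)
       (While (Eq (Cell ''lab'' (Cell ''input'' (N 3))) (var ''r'')) (Seq trace (search fw bw)))"

text \<open>
  The first phase augments to a maximum flow, and the paths it writes are overwritten by the
  second one, which decomposes this flow. Output cells 0 and 1 are reserved for the two lengths.
\<close>

definition max_flow_program :: com where
  "max_flow_program =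
     Seq (phase 0 1)
    (Seq (Seq (Assign ''pos'' (N 0) (N 2)) (Assign ''cnt'' (N 0) (N 0)))
    (Seq (phase 1 2)
    (Seq (Assign ''output'' (N 1) (var ''cnt''))
         (Assign ''output'' (N 0) (Minus (var ''pos'') (N 1))))))"

text \<open>The list length and five header numbers fill cells 0 to 5, followed by
  \<open>inp 1\<close> node names and four cells per arc; 4j is formed by additions.\<close>

definition entry :: "nat \<Rightarrow> (nat \<Rightarrow> nat) \<Rightarrow> nat \<Rightarrow> nat" where
  "entry i inp j = inp (6 + i + inp 1 + (j + j + (j + j)))"

lemma aval_field [simp]: "aval (field i) m = entry i (m ''input'') (m ''j'' 0)"
  by (simp add: field_def entry_def)

lemma result_stored:
  assumes "stored (m ''output'') 1 ys" "m ''output'' 0 = length ys"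
  shows "result m = ys"
proof (rule nth_equalityI)
  show "length (result m) = length ys" using assms(2) by (simp add: result_def)
  show "result m ! i = ys ! i" if "i < length (result m)" for i
    using that assms by (simp add: result_def stored_def)
qed

definition path_blocks :: "nat list list \<Rightarrow> nat list" where
  "path_blocks ps = concat (map (\<lambda>p. length p # p @ [1, 1]) ps)"

lemma encode_solution_paths:
  "encode_solution (map (\<lambda>p. (p, 1, 1)) ps) = length ps # path_blocks ps"
  by (simp add: encode_solution_def path_blocks_def comp_def)

text \<open>A block has three numbers besides its arcs, and a nonempty path has at least one
  arc.\<close>

lemma length_path_blocks:
  "[] \<notin> set ps \<Longrightarrow> length (path_blocks ps) \<le> 4 * length (concat ps)"
proof (induction ps)
  case (Cons p ps)
  then have "1 \<le> length p" by (cases p) auto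
  moreover have "length (path_blocks (p # ps)) = length p + 3 + length (path_blocks ps)"
    "length (concat (p # ps)) = length p + length (concat ps)"
    by (simp_all add: path_blocks_def)
  moreover have "length (path_blocks ps) \<le> 4 * length (concat ps)"
    using Cons by simp
  ultimately show ?case by linarith
qed (simp add: path_blocks_def)


section \<open>Correctness and running time\<close>

locale gm_program = gm_instance G s t u \<Gamma>
  for G :: "(nat, nat) pre_digraph" (structure) and s t u \<Gamma>
begin

definition arc_list :: "nat list" where
  "arc_list = sorted_list_of_set (arcs G)"

lemma arc_list: "set arc_list = arcs G" "length arc_list = card (arcs G)"
  by (simp_all add: arc_list_def)

definition loaded :: "(nat \<Rightarrow> nat) \<Rightarrow> bool" where
  "loaded inp \<longleftrightarrow> inp 2 = card (arcs G) \<and> inp 3 = s \<and> inp 4 = t \<and>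
     (\<forall>j < card (arcs G). entry 0 inp j = arc_list ! j \<and>
        entry 1 inp j = tail G (arc_list ! j) \<and> entry 2 inp j = head G (arc_list ! j))"

lemma loaded_initial:
  "loaded (initial (encode_instance (G, s, t, u, \<Gamma>)) ''input'')"
proof -
  define xs where "xs = encode_instance (G, s, t, u, \<Gamma>)"
  define blk where "blk = (\<lambda>a. [a, tail G a, head G a, u a])"
  have xs: "xs = [card (verts G), card (arcs G), s, t, \<Gamma>] @ sorted_list_of_set (verts G) @
      concat (map blk arc_list)"
    by (simp add: xs_def blk_def arc_list_def)
  have len1: "length (blk a) = 4" for a by (simp add: blk_def)
  then have len: "length (concat (map blk as)) = 4 * length as" for as
    by (induction as) simp_all
  have nth: "concat (map blk as) ! (4 * j + i) = blk (as ! j) ! i" if "j < length as" "i < 4" for as i j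
    using that
  proof (induction as arbitrary: j)
    case (Cons a as)
    then show ?case
      by (cases j) (auto simp: nth_append len1)
  qed simp
  have lxs: "length xs = 5 + card (verts G) + 4 * card (arcs G)"
    by (simp add: xs len arc_list)
  have cell: "initial xs ''input'' (Suc i) = xs ! i" if "i < length xs" for i
    using that by (simp add: initial_def)
  have c: "initial xs ''input'' 1 = card (verts G)" "initial xs ''input'' 2 = card (arcs G)"
    "initial xs ''input'' 3 = s" "initial xs ''input'' 4 = t"
    using cell[of 0] cell[of 1] cell[of 2] cell[of 3] lxs
    by (simp_all add: xs numeral_eq_Suc)
  have e: "entry i (initial xs ''input'') j = blk (arc_list ! j) ! i"
    if "j < card (arcs G)" "i < 4" for i j
  proof -
    \<comment> \<open>The position in the list counted from 0; memory is shifted by one because cell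
      0 holds the length.\<close>
    let ?k = "5 + (card (verts G) + (4 * j + i))"
    have "4 * j + i < 4 * card (arcs G)" using that by simp
    then have "?k < length xs" using lxs by simp
    moreover have "6 + i + card (verts G) + (j + j + (j + j)) = Suc ?k" by simp
    ultimately have "entry i (initial xs ''input'') j = xs ! ?k"
      using cell[of ?k] by (simp only: entry_def c)
    also have "\<dots> = concat (map blk arc_list) ! (4 * j + i)"
      by (simp add: xs nth_append)
    also have "\<dots> = blk (arc_list ! j) ! i"
      using that arc_list by (intro nth) auto
    finally show ?thesis .
  qed
  from e[of _ 0] e[of _ 1] e[of _ 2] c show ?thesis
    unfolding loaded_def xs_def[symmetric] by (simp add: blk_def)
qed

section \<open>Exhaustive labelling of the nodes that reach the sink\<close>

definition labelled :: "mem \<Rightarrow> nat set" where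
  "labelled m = {v. m ''lab'' v = m ''r'' 0}"

text \<open>The bound on all labels guarantees that the next value of \<open>r\<close> is
  fresh.\<close>

definition searching :: "nat \<Rightarrow> nat \<Rightarrow> mem \<Rightarrow> bool" where
  "searching fw bw m \<longleftrightarrow>
     search_tree fw bw (m ''flow'') t (labelled m) (m ''arc'') (m ''node'') (m ''depth'') \<and>
     loaded (m ''input'') \<and> (\<forall>v. m ''lab'' v \<le> m ''r'' 0)"

text \<open>Arcs numbered below \<open>j\<close> already respect closure; once \<open>j\<close>
  reaches the number of arcs, this is \<open>residual_closed\<close>.\<close>

definition scan :: "nat \<Rightarrow> nat \<Rightarrow> mem \<Rightarrow> mem \<Rightarrow> bool" where
  "scan fw bw m0 m \<longleftrightarrow> searching fw bw m \<and>
     (\<forall>x\<in>{''input'', ''flow'', ''output'', ''pos'', ''cnt''}. m x = m0 x) \<and>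
     m ''j'' 0 \<le> card (arcs G) \<and>
     (\<forall>i < m ''j'' 0. \<forall>v w. residual fw bw (m ''flow'') (arc_list ! i) v w \<longrightarrow>
        w \<in> labelled m \<longrightarrow> v \<in> labelled m)"

text \<open>A lexicographic measure as one number: a new label outweighs the reset of
  \<open>j\<close>, which adds at most \<open>card (arcs G)\<close>.\<close>

definition unscanned :: "mem \<Rightarrow> nat" where
  "unscanned m = (card (verts G) - card (labelled m)) * Suc (card (arcs G))
     + (card (arcs G) - m ''j'' 0)"

text \<open>With \<open>j\<close> back at 0 the closure part of \<open>scan\<close> is vacuous, so
  only the enlarged tree has to be checked.\<close>

lemma visit_scan:
  assumes m: "scan fw bw m0 m" "m ''j'' 0 < card (arcs G)"
    and a: "entry 0 (m ''input'') (m ''j'' 0) = a"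
    and v: "entry i (m ''input'') (m ''j'' 0) = v"
    and w: "entry k (m ''input'') (m ''j'' 0) = w"
    and r: "residual fw bw (m ''flow'') a v w" "w \<in> labelled m" "v \<notin> labelled m"
  shows "wp (visit i k) (\<lambda>m'. scan fw bw m0 m' \<and> unscanned m' < unscanned m) m"
proof -
  define m' where "m' = m(''lab'' := (m ''lab'')(v := m ''r'' 0), ''arc'' := (m ''arc'')(v := a),
    ''node'' := (m ''node'')(v := w), ''depth'' := (m ''depth'')(v := Suc (m ''depth'' w)),
    ''j'' := (m ''j'')(0 := 0))"
  have L: "labelled m' = insert v (labelled m)"
    by (auto simp: labelled_def m'_def)
  have T: "search_tree fw bw (m ''flow'') t (labelled m) (m ''arc'') (m ''node'') (m ''depth'')"
    using m(1) unfolding scan_def searching_def by blast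
  have T': "search_tree fw bw (m' ''flow'') t (labelled m') (m' ''arc'') (m' ''node'') (m' ''depth'')"
    unfolding L using search_tree_insert[OF T r] by (simp add: m'_def)
  have "scan fw bw m0 m'"
    using m T' unfolding scan_def searching_def
    by (auto simp: m'_def)
  moreover have "unscanned m' < unscanned m"
  proof -
    have sub: "insert v (labelled m) \<subseteq> verts G"
      using T' by (simp add: search_tree_def L)
    then have fin: "finite (insert v (labelled m))" using finite_verts by (rule finite_subset)
    have "card (labelled m') = Suc (card (labelled m))" "card (labelled m') \<le> card (verts G)"
      unfolding L using fin r(3) card_mono[OF finite_verts sub] by simp_all
    then obtain x where "card (verts G) - card (labelled m) = Suc x"
      "card (verts G) - card (labelled m') = x"
      by (metis Suc_diff_le diff_Suc_Suc)
    then show ?thesis using m(2) by (simp add: unscanned_def m'_def)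
  qed
  moreover have "wp (visit i k) Q m \<longleftrightarrow> Q m'" for Q
    using a v w by (simp add: visit_def m'_def)
  ultimately show ?thesis by blast
qed

lemma search_step_scan:
  assumes m: "scan fw bw m0 m" "m ''j'' 0 < card (arcs G)"
  shows "wp (search_step fw bw) (\<lambda>m'. scan fw bw m0 m' \<and> unscanned m' < unscanned m) m"
proof -
  define a where "a = arc_list ! (m ''j'' 0)"
  have ld: "loaded (m ''input'')"
    using m(1) unfolding scan_def searching_def by blast
  have inp: "entry 0 (m ''input'') (m ''j'' 0) = a" "entry 1 (m ''input'') (m ''j'' 0) = tail G a"
    "entry 2 (m ''input'') (m ''j'' 0) = head G a"
    using m(2) ld by (simp_all add: loaded_def a_def)
  have a: "a \<in> arcs G"
    unfolding a_def using m(2) arc_list by (metis nth_mem)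
  let ?Q = "\<lambda>m'. scan fw bw m0 m' \<and> unscanned m' < unscanned m"
  let ?c1 = "head G a \<in> labelled m \<and> tail G a \<notin> labelled m \<and> m ''flow'' a = fw"
  let ?c2 = "tail G a \<in> labelled m \<and> head G a \<notin> labelled m \<and> m ''flow'' a = bw"
  have c1: "wp (visit 1 2) ?Q m" if ?c1
    by (rule visit_scan[OF m inp(1,2,3)]) (use that a in \<open>auto simp: residual_def\<close>)
  have c2: "wp (visit 2 1) ?Q m" if ?c2
    by (rule visit_scan[OF m inp(1,3,2)]) (use that a in \<open>auto simp: residual_def\<close>)
  have c3: "wp (Assign ''j'' (N 0) (Plus (var ''j'') (N 1))) ?Q m" if "\<not> ?c1" "\<not> ?c2"
  proof -
    define m' where "m' = m(''j'' := (m ''j'')(0 := m ''j'' 0 + 1))"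
    have L: "labelled m' = labelled m" by (simp add: labelled_def m'_def)
    have "v \<in> labelled m" if "residual fw bw (m ''flow'') a v w" "w \<in> labelled m" for v w
      using that \<open>\<not> ?c1\<close> \<open>\<not> ?c2\<close> by (auto simp: residual_def)
    then have "scan fw bw m0 m'"
      using m unfolding scan_def searching_def L
      by (auto simp: m'_def less_Suc_eq a_def)
    moreover have "unscanned m' < unscanned m"
      using m(2) unfolding unscanned_def L by (simp add: m'_def)
    ultimately show ?thesis by (simp add: m'_def)
  qed
  from c1 c2 c3 show ?thesis
    by (simp add: search_step_def inp labelled_def del: wp.simps(2,3) One_nat_def)
qed

definition ready :: "mem \<Rightarrow> bool" where
  "ready m \<longleftrightarrow> loaded (m ''input'') \<and> (\<forall>v. m ''lab'' v \<le> m ''r'' 0)"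

text \<open>The 8 is a test plus the cost 7 of \<open>search_step\<close>; the 5 is the
  initialization plus the final test; the bracket is the largest value of
  \<open>unscanned\<close>.\<close>

definition search_time :: nat where
  "search_time = 5 + 8 * (card (verts G) * Suc (card (arcs G)) + card (arcs G))"

lemma search_init_scan:
  assumes "ready m"
  shows "wp search_init (scan fw bw m) m"
proof -
  let ?r = "Suc (m ''r'' 0)"
  define m' where "m' = m(''r'' := (m ''r'')(0 := ?r), ''lab'' := (m ''lab'')(t := ?r),
    ''depth'' := (m ''depth'')(t := 0), ''j'' := (m ''j'')(0 := 0))"
  have lab: "m ''lab'' v \<le> m ''r'' 0" for v using assms by (simp add: ready_def)
  have "m ''lab'' v \<noteq> ?r" for v using lab[of v] by simp
  then have L: "labelled m' = {t}" by (auto simp: labelled_def m'_def)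
  have "searching fw bw m'"
    using assms sink_in_verts lab unfolding searching_def L
    by (auto simp: m'_def ready_def le_SucI intro!: search_tree_root)
  then have "scan fw bw m m'" by (simp add: scan_def m'_def)
  moreover have "wp search_init Q m \<longleftrightarrow> Q m'" for Q
    using assms by (simp add: search_init_def m'_def ready_def loaded_def)
  ultimately show ?thesis by simp
qed

lemma search_correct:
  assumes "ready m"
  shows "reaches (search fw bw) m search_time (\<lambda>m'. searching fw bw m' \<and>
    residual_closed fw bw (m' ''flow'') (labelled m') \<and>
    (\<forall>x\<in>{''flow'', ''output'', ''pos'', ''cnt''}. m' x = m x))"
    (is "reaches _ _ _ ?Q")
proof -
  let ?W = "card (verts G) * Suc (card (arcs G)) + card (arcs G)"
  have "reaches (search fw bw) m (cost search_init + (1 + 8 * ?W)) ?Q"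
    unfolding search_def
  proof (rule reaches_Seq[OF wp_reaches[OF search_init_scan[OF assms]]])
    fix m1 assume m1: "scan fw bw m m1"
    have "reaches (While (Less (var ''j'') (Cell ''input'' (N 2))) (search_step fw bw)) m1
      (1 + (1 + cost (search_step fw bw)) * unscanned m1) ?Q"
    proof (rule reaches_While[where I = "scan fw bw m"])
      fix m' assume m': "scan fw bw m m'" "bval (Less (var ''j'') (Cell ''input'' (N 2))) m'"
      from m'(1) have "loaded (m' ''input'')" unfolding scan_def searching_def by (elim conjE)
      with m'(2) have "m' ''j'' 0 < card (arcs G)" by (simp add: loaded_def)
      then show "reaches (search_step fw bw) m' (cost (search_step fw bw))
          (\<lambda>m''. scan fw bw m m'' \<and> unscanned m'' < unscanned m')"
        using m' by (intro wp_reaches search_step_scan)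
    next
      fix m' assume m': "scan fw bw m m'" "\<not> bval (Less (var ''j'') (Cell ''input'' (N 2))) m'"
      from m'(1) have "loaded (m' ''input'')"
        unfolding scan_def searching_def by (elim conjE)
      moreover from m'(1) have "m' ''j'' 0 \<le> card (arcs G)"
        unfolding scan_def searching_def by (elim conjE)
      ultimately have j: "m' ''j'' 0 = card (arcs G)"
        using m'(2) by (simp add: loaded_def)
      have "residual_closed fw bw (m' ''flow'') (labelled m')"
        unfolding residual_closed_def
      proof (intro allI impI)
        fix a v w assume r: "residual fw bw (m' ''flow'') a v w" "w \<in> labelled m'"
        then have "a \<in> set arc_list" by (simp add: residual_def arc_list)
        then obtain i where "i < card (arcs G)" "a = arc_list ! i"
          unfolding in_set_conv_nth arc_list(2) by blast
        with r m' j show "v \<in> labelled m'" by (auto simp: scan_def)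
      qed
      with m' show "?Q m'" by (simp add: scan_def)
    qed (rule m1)
    moreover have "(1 + cost (search_step fw bw)) * unscanned m1 \<le> 8 * ?W"
      unfolding unscanned_def
      by (intro mult_le_mono add_mono) (simp_all add: search_step_def visit_def)
    ultimately show "reaches (While (Less (var ''j'') (Cell ''input'' (N 2))) (search_step fw bw)) m1
        (1 + 8 * ?W) ?Q"
      by (auto elim: reaches_mono)
  qed
  then show ?thesis
    by (rule reaches_mono) (simp add: search_time_def search_init_def)
qed

section \<open>Writing a path and flipping the flow along it\<close>

definition trace_inv :: "mem \<Rightarrow> nat list \<Rightarrow> mem \<Rightarrow> bool" where
  "trace_inv m0 p m \<longleftrightarrow>
     (\<forall>x\<in>{''input'', ''lab'', ''r'', ''arc'', ''node'', ''depth'', ''cnt''}. m x = m0 x) \<and>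
     m ''v'' 0 \<in> labelled m0 \<and>
     (\<exists>q. q @ tree_path (m ''arc'') (m ''node'') (m ''depth'' (m ''v'' 0)) (m ''v'' 0) = p \<and>
        m ''flow'' = flip (m0 ''flow'') (set q) \<and>
        m ''pos'' 0 = m0 ''pos'' 0 + 1 + length q \<and>
        stored (m ''output'') (m0 ''pos'' 0) (length p # q) \<and>
        (\<forall>i < m0 ''pos'' 0. m ''output'' i = m0 ''output'' i))"

text \<open>Tracing alters the flow but not the pointer and depth arrays, so the tree built for the
  old flow can still be followed. The witness \<open>q\<close> is the part of \<open>p\<close>
  already written.\<close>

lemma trace_step_inv:
  assumes T: "search_tree fw bw f t (labelled m0) (m0 ''arc'') (m0 ''node'') (m0 ''depth'')"
    and p: "distinct p" and m: "trace_inv m0 p m" and v: "m ''v'' 0 \<noteq> t"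
  shows "wp trace_step
    (\<lambda>m'. trace_inv m0 p m' \<and> m' ''depth'' (m' ''v'' 0) < m ''depth'' (m ''v'' 0)) m"
proof -
  define v where "v = m ''v'' 0"
  define a where "a = m ''arc'' v"
  define w where "w = m ''node'' v"
  define m' where "m' = m(''output'' := (m ''output'')(m ''pos'' 0 := a),
    ''pos'' := (m ''pos'')(0 := Suc (m ''pos'' 0)),
    ''flow'' := (m ''flow'')(a := 1 - m ''flow'' a), ''v'' := (m ''v'')(0 := w))"
  have keep: "\<forall>x\<in>{''input'', ''lab'', ''r'', ''arc'', ''node'', ''depth'', ''cnt''}. m x = m0 x"
    using m unfolding trace_inv_def by (rule conjunct1)
  have vL: "v \<in> labelled m0"
    using m unfolding trace_inv_def v_def by (elim conjE)
  obtain q where q: "q @ tree_path (m ''arc'') (m ''node'') (m ''depth'' v) v = p"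
    "m ''flow'' = flip (m0 ''flow'') (set q)" "m ''pos'' 0 = m0 ''pos'' 0 + 1 + length q"
    "stored (m ''output'') (m0 ''pos'' 0) (length p # q)"
    "\<forall>i < m0 ''pos'' 0. m ''output'' i = m0 ''output'' i"
    using m unfolding trace_inv_def v_def by (elim conjE exE)
  have T': "search_tree fw bw f t (labelled m0) (m ''arc'') (m ''node'') (m ''depth'')"
    using T keep by simp
  have wL: "w \<in> labelled m0" and d: "m ''depth'' v = Suc (m ''depth'' w)"
    using search_tree_next[OF T' vL] v unfolding v_def w_def by simp_all
  have q': "(q @ [a]) @ tree_path (m ''arc'') (m ''node'') (m ''depth'' w) w = p"
    using q(1) unfolding d by (simp add: a_def w_def)
  \<comment> \<open>Hence \<open>a\<close> still has its old value, and flipping it in place agrees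
    with \<open>flip\<close> along the longer prefix.\<close>
  then have "a \<notin> set q" using p by auto
  then have "(m ''flow'')(a := 1 - m ''flow'' a) = flip (m0 ''flow'') (set (q @ [a]))"
    unfolding q(2) by (auto simp: flip_def)
  moreover have "stored ((m ''output'')(m ''pos'' 0 := a)) (m0 ''pos'' 0) (length p # q @ [a])"
    using q(3,4) stored_append[of _ _ "length p # q" "[a]"]
    by (simp add: stored_upd) (simp add: stored_def)
  ultimately have "trace_inv m0 p m'"
    unfolding trace_inv_def using keep wL q' q(3,5)
    by (intro conjI exI[of _ "q @ [a]"]) (simp_all add: m'_def)
  moreover have "m' ''depth'' (m' ''v'' 0) < m ''depth'' (m ''v'' 0)"
    using d by (simp add: m'_def v_def)
  moreover have "wp trace_step Q m \<longleftrightarrow> Q m'" for Q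
    by (simp add: trace_step_def m'_def a_def v_def w_def)
  ultimately show ?thesis by blast
qed

text \<open>Three initial and four final assignments and the failing test make 8; a loop step is a
  test and four assignments.\<close>

definition trace_time :: nat where
  "trace_time = 8 + 5 * card (verts G)"

lemma trace_correct:
  assumes m: "searching fw bw m" and s: "s \<in> labelled m" and "fw \<noteq> bw"
  defines "p \<equiv> tree_path (m ''arc'') (m ''node'') (m ''depth'' s) s"
  shows "reaches trace m trace_time (\<lambda>m'. ready m' \<and>
    m' ''flow'' = flip (m ''flow'') (set p) \<and>
    m' ''pos'' 0 = m ''pos'' 0 + length p + 3 \<and> m' ''cnt'' 0 = Suc (m ''cnt'' 0) \<and>
    stored (m' ''output'') (m ''pos'' 0) (length p # p @ [1, 1]) \<and>
    (\<forall>i < m ''pos'' 0. m' ''output'' i = m ''output'' i))"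
    (is "reaches _ _ _ ?Q")
proof -
  have T: "search_tree fw bw (m ''flow'') t (labelled m) (m ''arc'') (m ''node'') (m ''depth'')"
    and ld: "loaded (m ''input'')" and lab: "\<forall>v. m ''lab'' v \<le> m ''r'' 0"
    using m unfolding searching_def by blast+
  have inp: "m ''input'' 3 = s" "m ''input'' 4 = t" using ld by (simp_all add: loaded_def)
  have p: "distinct p" unfolding p_def by (rule distinct_tree_path[OF T s \<open>fw \<noteq> bw\<close>])
  have depth: "m ''depth'' s \<le> card (verts G)"
    using search_tree_nodes(4)[OF T s] card_mono[OF finite_verts search_tree_nodes(1)[OF T]]
    by simp
  let ?I = "\<lambda>m'. trace_inv m p m'"
  let ?b = "Not (Eq (var ''v'') (Cell ''input'' (N 4)))"
  define m1 where "m1 = m(''v'' := (m ''v'')(0 := s),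
    ''output'' := (m ''output'')(m ''pos'' 0 := m ''depth'' s),
    ''pos'' := (m ''pos'')(0 := m ''pos'' 0 + 1))"
  have "trace_inv m p m1"
    unfolding trace_inv_def using s
    by (intro conjI exI[of _ "[]"])
      (simp_all add: m1_def p_def stored_Cons stored_Nil flip_def fun_eq_iff)
  moreover have "m1 ''depth'' (m1 ''v'' 0) = m ''depth'' s" by (simp add: m1_def)
  moreover have "wp trace_init Q m \<longleftrightarrow> Q m1" for Q
    by (simp add: trace_init_def m1_def inp)
  ultimately have "wp trace_init (\<lambda>m'. ?I m' \<and> m' ''depth'' (m' ''v'' 0) = m ''depth'' s) m"
    by blast
  note init = wp_reaches[OF this]
  have loop: "reaches (While ?b trace_step) m' (1 + 5 * m ''depth'' s)
      (\<lambda>m'. ?I m' \<and> m' ''v'' 0 = t)"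
    if m': "?I m' \<and> m' ''depth'' (m' ''v'' 0) = m ''depth'' s" for m'
  proof -
    have bv: "bval ?b m'' \<longleftrightarrow> m'' ''v'' 0 \<noteq> t" if "?I m''" for m''
      using that inp by (simp add: trace_inv_def)
    have "reaches (While ?b trace_step) m' (1 + (1 + cost trace_step) * m' ''depth'' (m' ''v'' 0))
        (\<lambda>m'. ?I m' \<and> m' ''v'' 0 = t)"
    proof (rule reaches_While[where I = ?I and V = "\<lambda>m'. m' ''depth'' (m' ''v'' 0)"])
      show "?I m'" using m' by blast
      fix m'' assume m'': "?I m''"
      show "reaches trace_step m'' (cost trace_step)
          (\<lambda>k. ?I k \<and> k ''depth'' (k ''v'' 0) < m'' ''depth'' (m'' ''v'' 0))" if "bval ?b m''"
        using trace_step_inv[OF T p m''] bv[OF m''] that by (intro wp_reaches) blast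
      show "?I m'' \<and> m'' ''v'' 0 = t" if "\<not> bval ?b m''"
        using m'' bv[OF m''] that by blast
    qed
    moreover have "(1 + cost trace_step) * m' ''depth'' (m' ''v'' 0) = 5 * m ''depth'' s"
      using m' by (simp add: trace_step_def)
    ultimately show ?thesis by simp
  qed
  have fin: "wp trace_end ?Q m'" if m': "?I m' \<and> m' ''v'' 0 = t" for m'
  proof -
    define m'' where "m'' = m'(''output'' := (m' ''output'')(m' ''pos'' 0 := 1,
        m' ''pos'' 0 + 1 := 1), ''pos'' := (m' ''pos'')(0 := m' ''pos'' 0 + 2),
        ''cnt'' := (m' ''cnt'')(0 := m' ''cnt'' 0 + 1))"
    have keep: "\<forall>x\<in>{''input'', ''lab'', ''r'', ''arc'', ''node'', ''depth'', ''cnt''}. m' x = m x"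
      using m' unfolding trace_inv_def by (elim conjE)
    \<comment> \<open>At the root the remaining tree path is empty, so the written prefix is all of
      \<open>p\<close>.\<close>
    have "m' ''depth'' t = 0" using keep search_tree_nodes(3)[OF T] by simp
    then have q: "m' ''flow'' = flip (m ''flow'') (set p)"
      "m' ''pos'' 0 = m ''pos'' 0 + 1 + length p"
      "stored (m' ''output'') (m ''pos'' 0) (length p # p)"
      "\<forall>i < m ''pos'' 0. m' ''output'' i = m ''output'' i"
      using m' unfolding trace_inv_def by auto
    have "stored (m'' ''output'') (m ''pos'' 0) ((length p # p) @ [1, 1])"
      unfolding stored_append using q(2,3)
      by (simp add: m''_def stored_upd) (simp add: stored_Cons stored_Nil)
    then have "?Q m''"
      using keep q(1,2,4) ld lab by (simp add: m''_def ready_def)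
    moreover have "wp trace_end Q m' \<longleftrightarrow> Q m''" for Q
      by (simp add: trace_end_def m''_def)
    ultimately show ?thesis by blast
  qed
  have "reaches trace m (cost trace_init + (1 + 5 * m ''depth'' s + cost trace_end)) ?Q"
    unfolding trace_def
    by (rule reaches_Seq[OF init], erule reaches_Seq[OF loop], rule wp_reaches, erule fin)
  then show ?thesis
    by (rule reaches_mono)
      (use depth in \<open>simp_all add: trace_time_def trace_init_def trace_end_def\<close>)
qed

section \<open>Rounds of search and trace\<close>

definition phase_time :: nat where
  "phase_time = search_time + (1 + (1 + (trace_time + search_time)) * card (arcs G))"

text \<open>\<open>R\<close> and \<open>V\<close> are parameters because the phases differ only in
  them: the first ignores what is written, the second records it. \<open>R\<close> sees only data
  that a search leaves unchanged.\<close>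

lemma phase_correct:
  fixes V :: "(nat \<Rightarrow> nat) \<Rightarrow> nat"
    and R :: "(nat \<Rightarrow> nat) \<Rightarrow> (nat \<Rightarrow> nat) \<Rightarrow> nat \<Rightarrow> nat \<Rightarrow> bool"
  assumes m: "ready m" and "fw \<noteq> bw"
    and R: "R (m ''flow'') (m ''output'') (m ''pos'' 0) (m ''cnt'' 0)"
    and V: "V (m ''flow'') \<le> card (arcs G)"
    and step: "\<And>f out pos cnt L na nv d p out'. R f out pos cnt \<Longrightarrow>
      search_tree fw bw f t L na nv d \<Longrightarrow> s \<in> L \<Longrightarrow> p = tree_path na nv (d s) s \<Longrightarrow>
      stored out' pos (length p # p @ [1, 1]) \<Longrightarrow> \<forall>i<pos. out' i = out i \<Longrightarrow>
      R (flip f (set p)) out' (pos + length p + 3) (Suc cnt) \<and> V (flip f (set p)) < V f"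
  shows "reaches (phase fw bw) m phase_time (\<lambda>m'. ready m' \<and>
    R (m' ''flow'') (m' ''output'') (m' ''pos'' 0) (m' ''cnt'' 0) \<and>
    (\<exists>L\<subseteq>verts G. t \<in> L \<and> s \<notin> L \<and> residual_closed fw bw (m' ''flow'') L))"
    (is "reaches _ _ _ ?Q")
proof -
  let ?R = "\<lambda>m. R (m ''flow'') (m ''output'') (m ''pos'' 0) (m ''cnt'' 0)"
  let ?I = "\<lambda>m. ?R m \<and> searching fw bw m \<and> residual_closed fw bw (m ''flow'') (labelled m)"
  let ?b = "Eq (Cell ''lab'' (Cell ''input'' (N 3))) (var ''r'')"
  have search: "reaches (search fw bw) m' search_time (\<lambda>m''. ?I m'' \<and> m'' ''flow'' = m' ''flow'')"
    if "ready m'" "?R m'" for m'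
    by (rule reaches_mono[OF search_correct[OF that(1), of fw bw]]) (use that(2) in auto)
  have bv: "bval ?b m' \<longleftrightarrow> s \<in> labelled m'" if "?I m'" for m'
    using that by (simp add: searching_def loaded_def labelled_def)
  have round: "reaches (Seq trace (search fw bw)) m' (trace_time + search_time)
      (\<lambda>m''. ?I m'' \<and> V (m'' ''flow'') < V (m' ''flow''))"
    if m': "?I m'" "bval ?b m'" for m'
  proof -
    have s: "s \<in> labelled m'" using m' bv by blast
    have srch: "searching fw bw m'" using m' by blast
    then have T: "search_tree fw bw (m' ''flow'') t (labelled m') (m' ''arc'') (m' ''node'')
        (m' ''depth'')"
      unfolding searching_def by blast
    have "reaches trace m' trace_time (\<lambda>m''. ready m'' \<and> ?R m'' \<and> V (m'' ''flow'') < V (m' ''flow''))"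
      by (rule reaches_mono[OF trace_correct[OF srch s \<open>fw \<noteq> bw\<close>]])
        (use step[OF _ T s refl] m'(1) in auto)
    then show ?thesis
      by (rule reaches_Seq) (rule reaches_mono[OF search], auto)
  qed
  have loop: "reaches (While ?b (Seq trace (search fw bw))) m'
      (1 + (1 + (trace_time + search_time)) * card (arcs G)) ?Q"
    if m': "?I m' \<and> m' ''flow'' = m ''flow''" for m'
  proof -
    have "reaches (While ?b (Seq trace (search fw bw))) m'
      (1 + (1 + (trace_time + search_time)) * V (m' ''flow'')) ?Q"
    proof (rule reaches_While[where I = ?I and V = "\<lambda>m. V (m ''flow'')"])
      fix m'' assume m'': "?I m''" "\<not> bval ?b m''"
      then have "s \<notin> labelled m''" "searching fw bw m''" using bv by blast+
      moreover from this(2) have "ready m''"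
        by (simp add: searching_def ready_def)
      moreover have "labelled m'' \<subseteq> verts G" "t \<in> labelled m''"
        using search_tree_nodes(1,2)[of fw bw "m'' ''flow''" t "labelled m''"] m''(1)
        unfolding searching_def by metis+
      ultimately show "?Q m''"
        using m''(1) by (intro conjI exI[of _ "labelled m''"]) simp_all
    qed (use m' round in blast)+
    then show ?thesis
      by (rule reaches_mono) (use m' V in \<open>auto intro!: add_mono mult_le_mono\<close>)
  qed
  show ?thesis
    unfolding phase_def phase_time_def
    by (rule reaches_Seq[OF search[OF m R] loop])
qed

text \<open>\<open>K\<close> is the value before decomposition, split into what is left and what is
  written. Value 0 on written arcs keeps later paths disjoint from them, as those use arcs of value
  1 only. The offset 2 skips the reserved cells.\<close>

definition decomposed where
  "decomposed K f out pos cnt \<longleftrightarrow> is_flow f \<and> (\<exists>ps. length ps = cnt \<and>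
     excess f s + int cnt = K \<and> (\<forall>p\<in>set ps. apath s p t) \<and> distinct (concat ps) \<and>
     (\<forall>a\<in>set (concat ps). f a = 0) \<and> stored out 2 (path_blocks ps) \<and>
     pos = 2 + length (path_blocks ps))"

lemma decomposed_step:
  assumes D: "decomposed K f out pos cnt"
    and T: "search_tree 1 2 f t L na nv d" and s: "s \<in> L"
    and p: "p = tree_path na nv (d s) s"
    and st: "stored out' pos (length p # p @ [1, 1])" and same: "\<forall>i<pos. out' i = out i"
  shows "decomposed K (flip f (set p)) out' (pos + length p + 3) (Suc cnt)"
    and "nat (excess (flip f (set p)) s) < nat (excess f s)"
proof -
  obtain ps where f: "is_flow f" and ps: "length ps = cnt" "excess f s + int cnt = K"
    "\<forall>p\<in>set ps. apath s p t" "distinct (concat ps)" "\<forall>a\<in>set (concat ps). f a = 0"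
    "stored out 2 (path_blocks ps)" "pos = 2 + length (path_blocks ps)"
    using D unfolding decomposed_def by (elim conjE exE)
  have f01: "f a \<le> 1" if "a \<in> arcs G" for a using f that by (simp add: is_flow_def)
  have path: "apath s p t" "\<forall>a\<in>set p. f a = 1"
    using tree_path_apath[OF T s f01] unfolding p by blast+
  have dist: "distinct p" unfolding p by (rule distinct_tree_path[OF T s]) simp
  have "set (concat ps) \<inter> set p = {}" using path(2) ps(5) by fastforce
  then have dist': "distinct (concat (ps @ [p]))" using dist ps(4) by simp
  have zero: "\<forall>a\<in>set (concat (ps @ [p])). flip f (set p) a = 0"
    using path(2) ps(5) by (auto simp: flip_def)
  have ff: "is_flow (flip f (set p))"
    unfolding p by (rule flip_flow(1)[OF f T s]) simp_all
  have e: "excess (flip f (set p)) s = excess f s - 1"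
    unfolding p by (subst flip_flow(2)[OF f T s]) simp_all
  have blocks: "path_blocks (ps @ [p]) = path_blocks ps @ length p # p @ [1, 1]"
    by (simp add: path_blocks_def)
  have "stored out' 2 (path_blocks ps)"
    using ps(6) by (rule stored_cong) (use same ps(7) in simp)
  then have st': "stored out' 2 (path_blocks (ps @ [p]))"
    using st unfolding blocks stored_append[of _ _ "path_blocks ps"] ps(7) by simp
  show "decomposed K (flip f (set p)) out' (pos + length p + 3) (Suc cnt)"
    unfolding decomposed_def
  proof (intro conjI exI[of _ "ps @ [p]"])
    show "\<forall>p\<in>set (ps @ [p]). apath s p t" using ps(3) path(1) by simp
    show "pos + length p + 3 = 2 + length (path_blocks (ps @ [p]))"
      by (simp add: blocks ps(7))
  qed (use ff e zero dist' st' ps(1,2) in simp_all)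
  show "nat (excess (flip f (set p)) s) < nat (excess f s)"
    using excess_source_bounds(1)[OF ff] e by simp
qed

lemma augment_step:
  assumes f: "is_flow f" and T: "search_tree 0 1 f t L na nv d" and s: "s \<in> L"
    and p: "p = tree_path na nv (d s) s"
  shows "is_flow (flip f (set p)) \<and>
    nat (int (card (arcs G)) - excess (flip f (set p)) s)
      < nat (int (card (arcs G)) - excess f s)"
proof -
  have ff: "is_flow (flip f (set p))"
    unfolding p by (rule flip_flow(1)[OF f T s]) simp_all
  have e: "excess (flip f (set p)) s = excess f s + 1"
    unfolding p by (subst flip_flow(2)[OF f T s]) simp_all
  show ?thesis using ff e excess_source_bounds(2)[OF ff] by simp
qed

lemma max_flow_program_correct:
  assumes unit: "\<And>a. a \<in> arcs G \<Longrightarrow> u a = 1"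
  shows "reaches max_flow_program (initial (encode_instance (G, s, t, u, \<Gamma>)))
    (phase_time + (2 + (phase_time + 2)))
    (\<lambda>m. encodes_optimal_solution (G, s, t, u, \<Gamma>) (result m) \<and>
       length (result m) \<le> 1 + 4 * card (arcs G))"
    (is "reaches _ ?m0 _ ?Q")
proof -
  let ?closed = "\<lambda>fw bw f. \<exists>L\<subseteq>verts G. t \<in> L \<and> s \<notin> L \<and> residual_closed fw bw f L"
  let ?C = "\<lambda>L. {a \<in> arcs G. tail G a \<notin> L \<and> head G a \<in> L}"
  have zero: "?m0 x = (\<lambda>_. 0)" if "x \<noteq> ''input''" for x
    using that by (auto simp: initial_def)
  have rdy: "ready ?m0"
    unfolding ready_def using loaded_initial zero[of "''lab''"] by simp
  have flow0: "is_flow (?m0 ''flow'')"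
    unfolding is_flow_def excess_def using zero[of "''flow''"] by simp
  have phase1: "reaches (phase 0 1) ?m0 phase_time
    (\<lambda>m. ready m \<and> is_flow (m ''flow'') \<and> ?closed 0 1 (m ''flow''))"
  proof (rule phase_correct[OF rdy, where R = "\<lambda>f _ _ _. is_flow f"
        and V = "\<lambda>f. nat (int (card (arcs G)) - excess f s)"])
    show "nat (int (card (arcs G)) - excess (?m0 ''flow'') s) \<le> card (arcs G)"
      using excess_source_bounds(1)[OF flow0] by simp
  qed (use flow0 augment_step in simp_all)
  have phase2: "reaches (phase 1 2) m phase_time
    (\<lambda>m'. ready m' \<and> decomposed K (m' ''flow'') (m' ''output'') (m' ''pos'' 0) (m' ''cnt'' 0) \<and>
       ?closed 1 2 (m' ''flow''))"
    if m: "ready m \<and> is_flow (m ''flow'') \<and> m ''pos'' 0 = 2 \<and> m ''cnt'' 0 = 0 \<and>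
      excess (m ''flow'') s = K" for m K
  proof (rule phase_correct[where R = "decomposed K" and V = "\<lambda>f. nat (excess f s)"])
    show "decomposed K (m ''flow'') (m ''output'') (m ''pos'' 0) (m ''cnt'' 0)"
      unfolding decomposed_def using m
      by (intro conjI exI[of _ "[]"]) (simp_all add: path_blocks_def stored_Nil)
    show "nat (excess (m ''flow'') s) \<le> card (arcs G)"
      using m excess_source_bounds(2)[of "m ''flow''"] by simp
    show "(1::nat) \<noteq> 2" by simp
    show "decomposed K (flip f (set p)) out' (pos + length p + 3) (Suc cnt) \<and>
        nat (excess (flip f (set p)) s) < nat (excess f s)"
      if "decomposed K f out pos cnt" "search_tree 1 2 f t L na nv d" "s \<in> L"
        "p = tree_path na nv (d s) s" "stored out' pos (length p # p @ [1, 1])"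
        "\<forall>i<pos. out' i = out i" for f out pos cnt L na nv d p out'
      using decomposed_step[OF that] by blast
  qed (use m in blast)
  let ?clr = "Seq (Assign ''pos'' (N 0) (N 2)) (Assign ''cnt'' (N 0) (N 0))"
  let ?fin = "Seq (Assign ''output'' (N 1) (var ''cnt''))
    (Assign ''output'' (N 0) (Minus (var ''pos'') (N 1)))"
  have finish: "wp ?fin ?Q m"
    if m: "decomposed (int (card (?C L))) (m ''flow'') (m ''output'') (m ''pos'' 0) (m ''cnt'' 0)"
      "?closed 1 2 (m ''flow'')" and L: "L \<subseteq> verts G" "t \<in> L" "s \<notin> L" for m L
  proof -
    obtain ps where f: "is_flow (m ''flow'')"
      and ps: "length ps = m ''cnt'' 0" "excess (m ''flow'') s + int (m ''cnt'' 0) = int (card (?C L))"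
        "\<forall>p\<in>set ps. apath s p t" "distinct (concat ps)"
        "stored (m ''output'') 2 (path_blocks ps)" "m ''pos'' 0 = 2 + length (path_blocks ps)"
      using m(1) unfolding decomposed_def by (elim conjE exE)
    have path: "apath s p t" if "p \<in> set ps" for p using ps(3) that by blast
    obtain L' where "L' \<subseteq> verts G" "t \<in> L'" "s \<notin> L'" "residual_closed 1 2 (m ''flow'') L'"
      using m(2) by blast
    \<comment> \<open>The second cut \<open>L'\<close> only shows that all units have become paths;
      optimality is certified by \<open>L\<close> from the first phase.\<close>
    then have "excess (m ''flow'') s = 0" using no_flow_closed[OF f] by blast
    then have len: "length ps = card (?C L)" using ps(1,2) by simp
    \<comment> \<open>\<open>pos\<close> is the first free cell, so cells 1 to
      \<open>pos - 1\<close> hold the output.\<close>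
    define m' where "m' = m(''output'' := (m ''output'')(1 := m ''cnt'' 0, 0 := m ''pos'' 0 - 1))"
    have "stored (m' ''output'') 2 (path_blocks ps)"
      using ps(5) by (simp add: stored_def m'_def)
    then have res: "result m' = encode_solution (map (\<lambda>p. (p, 1, 1)) ps)"
      unfolding encode_solution_paths using ps(1,6)
      by (intro result_stored) (simp_all add: stored_Cons m'_def numeral_2_eq_2)
    have "optimal (paths_flow ps)"
      using path ps(4) L len unit by (rule cut_many_disjoint_paths_optimal)
    moreover have "lists_flow (map (\<lambda>p. (p, 1, 1)) ps) (paths_flow ps)"
      using path ps(4) by (rule disjoint_paths_lists_flow)
    ultimately have sol: "encodes_optimal_solution (G, s, t, u, \<Gamma>) (result m')"
      unfolding res by auto
    have "[] \<notin> set ps"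
      using path[of "[]"] source_neq_sink unfolding apath_Nil_iff by blast
    then have "length (path_blocks ps) \<le> 4 * length (concat ps)" by (rule length_path_blocks)
    moreover have "length (concat ps) \<le> card (arcs G)"
    proof -
      have "set (concat ps) \<subseteq> arcs G" using path unfolding apath_def awalk_def by auto
      then show ?thesis using ps(4) card_mono[OF finite_arcs] by (metis distinct_card)
    qed
    ultimately have "length (result m') \<le> 1 + 4 * card (arcs G)"
      unfolding res encode_solution_paths by simp
    with sol have "?Q m'" ..
    moreover have "wp ?fin Q m \<longleftrightarrow> Q m'" for Q by (simp add: m'_def)
    ultimately show ?thesis by blast
  qed
  show ?thesis
    unfolding max_flow_program_def
  proof (rule reaches_Seq[OF phase1])
    fix m1 assume m1: "ready m1 \<and> is_flow (m1 ''flow'') \<and> ?closed 0 1 (m1 ''flow'')"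
    then obtain L where L: "L \<subseteq> verts G" "t \<in> L" "s \<notin> L" "residual_closed 0 1 (m1 ''flow'') L"
      by blast
    let ?K = "int (card (?C L))"
    have K: "excess (m1 ''flow'') s = ?K"
      using m1 L by (intro max_flow_closed) auto
    have "wp ?clr (\<lambda>m. ready m \<and> is_flow (m ''flow'') \<and> m ''pos'' 0 = 2 \<and> m ''cnt'' 0 = 0 \<and>
        excess (m ''flow'') s = ?K) m1"
      using m1 K by (simp add: ready_def)
    then have clr: "reaches ?clr m1 2 (\<lambda>m. ready m \<and> is_flow (m ''flow'') \<and> m ''pos'' 0 = 2 \<and>
        m ''cnt'' 0 = 0 \<and> excess (m ''flow'') s = ?K)"
      by (rule reaches_mono[OF wp_reaches]) simp_all
    have fin: "reaches ?fin m 2 ?Q"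
      if "ready m \<and> decomposed ?K (m ''flow'') (m ''output'') (m ''pos'' 0) (m ''cnt'' 0) \<and>
        ?closed 1 2 (m ''flow'')" for m
    proof -
      have "wp ?fin ?Q m" using that L by (intro finish) blast+
      then show ?thesis by (rule reaches_mono[OF wp_reaches]) simp_all
    qed
    show "reaches (Seq ?clr (Seq (phase 1 2) ?fin)) m1 (2 + (phase_time + 2)) ?Q"
      by (rule reaches_Seq[OF clr], erule reaches_Seq[OF phase2], erule fin)
  qed
qed

text \<open>With X = \<open>Suc b\<close>, a search and a trace take at most 8 X^2 each, a round 17
  X^2, all rounds 17 X^3, a phase 26 X^3. Two phases and the rest give at most 57 X^3, rounded
  up.\<close>

lemma max_flow_program_time:
  assumes n: "card (verts G) \<le> b" and M: "card (arcs G) \<le> b"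
  shows "phase_time + (2 + (phase_time + 2)) + (1 + 4 * card (arcs G)) \<le> 60 * Suc b ^ 3"
proof -
  let ?X = "Suc b"
  have "card (verts G) * Suc (card (arcs G)) + card (arcs G) \<le> b * ?X + b"
    using n M by (intro add_mono mult_le_mono) auto
  then have st: "search_time \<le> 8 * (?X * ?X)"
    by (simp add: search_time_def)
  have tt: "trace_time \<le> 8 * (?X * ?X)"
    using n by (simp add: trace_time_def)
  have "(1 + (trace_time + search_time)) * card (arcs G) \<le> 17 * (?X * ?X) * ?X"
    using st tt M by (intro mult_le_mono) auto
  moreover have "?X * ?X \<le> ?X * ?X * ?X" "?X \<le> ?X * ?X * ?X" by simp_all
  ultimately have "phase_time \<le> 26 * (?X * ?X * ?X)"
    using st unfolding phase_time_def by linarith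
  moreover have "5 + 4 * card (arcs G) \<le> 5 * (?X * ?X * ?X)"
    using M \<open>?X \<le> ?X * ?X * ?X\<close> by linarith
  ultimately have "phase_time + (2 + (phase_time + 2)) + (1 + 4 * card (arcs G)) \<le> 60 * (?X * ?X * ?X)"
    by linarith
  then show ?thesis by (simp only: power3_eq_cube)
qed

end

lemma length_le_input_size: "length xs \<le> input_size xs"
  by (induction xs) (auto simp: input_size_def)

theorem proposition3p5:
  shows "poly_time_solvable
    {(G, s, t, u, \<Gamma>). gm_instance G s t u \<Gamma> \<and> (\<forall>a \<in> arcs G. u a = 1)}
    encode_instance
    encodes_optimal_solution"
  unfolding poly_time_solvable_def
proof (intro exI[of _ max_flow_program] exI[of _ "[:60:] * [:1, 1:] ^ 3"] ballI)
  fix i :: gm_data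
  assume "i \<in> {(G, s, t, u, \<Gamma>). gm_instance G s t u \<Gamma> \<and> (\<forall>a \<in> arcs G. u a = 1)}"
  then obtain G s t u \<Gamma> where i: "i = (G, s, t, u, \<Gamma>)"
    and inst: "gm_instance G s t u \<Gamma>" and unit: "\<And>a. a \<in> arcs G \<Longrightarrow> u a = 1"
    by auto
  interpret gm_program G s t u \<Gamma>
    using inst by (rule gm_program.intro)
  let ?N = "input_size (encode_instance i)"
  \<comment> \<open>The encoding lists every node and arc, so these counts are polynomial in the
    input size however large the names are.\<close>
  have "card (verts G) + card (arcs G) \<le> length (encode_instance i)"
    by (simp add: i length_concat comp_def sum_list_triv)
  then have "card (verts G) \<le> ?N" "card (arcs G) \<le> ?N"
    using length_le_input_size[of "encode_instance i"] by linarith+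
  note time = max_flow_program_time[OF this]
  obtain k m where "exec max_flow_program (initial (encode_instance i)) k m"
    "k \<le> phase_time + (2 + (phase_time + 2))" "encodes_optimal_solution i (result m)"
    "length (result m) \<le> 1 + 4 * card (arcs G)"
    using max_flow_program_correct[OF unit] unfolding reaches_def i by blast
  moreover have "poly ([:60:] * [:1, 1:] ^ 3) ?N = 60 * Suc ?N ^ 3"
    by (simp add: poly_power)
  ultimately show "\<exists>k m. exec max_flow_program (initial (encode_instance i)) k m \<and>
      k + length (result m) \<le> poly ([:60:] * [:1, 1:] ^ 3) ?N \<and>
      encodes_optimal_solution i (result m)"
    using time by (intro exI[of _ k] exI[of _ m]) auto
qed

end
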